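(* Let $X$ be a simplicial complex, $C\subset X$ a subcomplex and $f:X\to X$ a homeomorphism such that $f(C)=C$. Let $Y$ be another simplicial complex, $D\subset Y$ a subcomplex and $g:Y\to Y$ a homeomorphism such that $g(D)=D$. If there exists a homeomorphism $h:X\setminus C\to Y\setminus D$ such that $g_{|Y\setminus D}\circ h=h\circ f_{|X\setminus C}$, then $$\varLambda(f,(X,C))=\varLambda(g,(Y,D)).$$ More generally, the same holds if, instead of being homeomorphisms with $f(C)=C$ and $g(D)=D$, the maps $f$ and $g$ are open (continuous) maps with $f(C)\subset C$, $f(X\setminus C)\subset X\setminus C$, $g(D)\subset D$ and $g(Y\setminus D)\subset Y\setminus D$.
   Context: Simplicial complexes are finite and identified with their underlying compact polyhedra. For a continuous map of pairs $f:(X,C)\to(X,C)$, $\varLambda(f,(X,C))$ denotes the relative Lefschetz number (Lefschetz number of a map of pairs), that is, $\sum_p(-1)^p\,\mathrm{tr}\bigl(f_*:H_p(X,C;\mathbb{Q})\to H_p(X,C;\mathbb{Q})\bigr)$. *)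

theory Defs
  imports "HOL-Analysis.Analysis" "HOL-Homology.Homology"
begin

section \<open>Traces on subquotients of a vector space\<close>

locale vector_space_quotient = vector_space scale
  for scale :: "'a::field \<Rightarrow> 'b::ab_group_add \<Rightarrow> 'b" (infixr \<open>*\<^sub>V\<close> 75)
begin

text \<open>
  For subspaces \<open>W \<subseteq> V\<close>, the finite set \<open>B \<subseteq> V\<close> maps injectively onto a basis of \<open>V / W\<close>.
\<close>

definition quotient_basis :: "'b set \<Rightarrow> 'b set \<Rightarrow> 'b set \<Rightarrow> bool" where
  "quotient_basis V W B \<longleftrightarrow> finite B \<and> B \<subseteq> V \<and>
     (\<forall>u. (\<Sum>b\<in>B. u b *\<^sub>V b) \<in> W \<longrightarrow> (\<forall>b\<in>B. u b = 0)) \<and>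
     (\<forall>v\<in>V. \<exists>u. v - (\<Sum>b\<in>B. u b *\<^sub>V b) \<in> W)"

text \<open>
  The trace of the endomorphism of \<open>V / W\<close> induced by \<open>\<phi>\<close>: the sum of the diagonal entries of its
  matrix \<open>m\<close> with respect to a basis of \<open>V / W\<close>. The value is only meaningful if \<open>V / W\<close> is
  finite-dimensional and \<open>\<phi>\<close> preserves \<open>V\<close> and \<open>W\<close>; in that case it does not depend on the basis,
  see \<open>quotient_trace_eqI\<close>.
\<close>

definition quotient_trace :: "'b set \<Rightarrow> 'b set \<Rightarrow> ('b \<Rightarrow> 'b) \<Rightarrow> 'a" where
  "quotient_trace V W \<phi> =
     (THE t. \<exists>B m. quotient_basis V W B \<and>
        (\<forall>b\<in>B. \<phi> b - (\<Sum>c\<in>B. m c b *\<^sub>V c) \<in> W) \<and> t = (\<Sum>b\<in>B. m b b))"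

lemma subspace_sum_scale_diff:
  assumes W: "subspace W" and B: "\<And>b. b \<in> B \<Longrightarrow> x b - y b \<in> W"
  shows "(\<Sum>b\<in>B. u b *\<^sub>V x b) - (\<Sum>b\<in>B. u b *\<^sub>V y b) \<in> W"
proof -
  have "(\<Sum>b\<in>B. u b *\<^sub>V (x b - y b)) \<in> W"
    using assms by (intro subspace_sum subspace_scale) auto
  then show ?thesis
    by (simp add: scale_right_diff_distrib sum_subtractf)
qed

lemma sum_scale_sum_scale:
  "(\<Sum>c\<in>C. u c *\<^sub>V (\<Sum>b\<in>B. P b c *\<^sub>V b)) = (\<Sum>b\<in>B. (\<Sum>c\<in>C. P b c * u c) *\<^sub>V b)"
  by (simp add: scale_sum_right scale_sum_left sum.swap[of _ C] mult.commute)

lemma quotient_basis_coeffs_eq: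
  assumes W: "subspace W" and B: "quotient_basis V W B"
    and u: "x - (\<Sum>b\<in>B. u b *\<^sub>V b) \<in> W" and v: "x - (\<Sum>b\<in>B. v b *\<^sub>V b) \<in> W" and b: "b \<in> B"
  shows "u b = v b"
proof -
  have "(x - (\<Sum>b\<in>B. v b *\<^sub>V b)) - (x - (\<Sum>b\<in>B. u b *\<^sub>V b)) \<in> W"
    using subspace_diff[OF W v u] .
  then have "(\<Sum>b\<in>B. (u b - v b) *\<^sub>V b) \<in> W"
    by (simp add: scale_left_diff_distrib sum_subtractf)
  then have "\<forall>b\<in>B. u b - v b = 0"
    using B unfolding quotient_basis_def by (elim conjE allE[of _ "\<lambda>b. u b - v b"]) blast
  then show ?thesis
    using b by simp
qed

lemma change_of_basis_inverse:
  assumes W: "subspace W" and B: "quotient_basis V W B"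
    and P: "\<And>c. c \<in> C \<Longrightarrow> c - (\<Sum>b\<in>B. P b c *\<^sub>V b) \<in> W"
    and Q: "\<And>b. b \<in> B \<Longrightarrow> b - (\<Sum>c\<in>C. Q c b *\<^sub>V c) \<in> W"
    and b: "b \<in> B" "b' \<in> B"
  shows "(\<Sum>c\<in>C. P b c * Q c b') = (if b = b' then 1 else 0)"
proof -
  have "(\<Sum>c\<in>C. Q c b' *\<^sub>V c) - (\<Sum>c\<in>C. Q c b' *\<^sub>V (\<Sum>b\<in>B. P b c *\<^sub>V b)) \<in> W"
    using P by (intro subspace_sum_scale_diff[OF W]) auto
  then have "(\<Sum>c\<in>C. Q c b' *\<^sub>V c) - (\<Sum>b\<in>B. (\<Sum>c\<in>C. P b c * Q c b') *\<^sub>V b) \<in> W"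
    by (simp only: sum_scale_sum_scale)
  from subspace_add[OF W Q[OF b(2)] this]
  have 1: "b' - (\<Sum>b\<in>B. (\<Sum>c\<in>C. P b c * Q c b') *\<^sub>V b) \<in> W"
    by simp
  have "finite B"
    using B by (simp add: quotient_basis_def)
  then have "(\<Sum>b\<in>B. (if b = b' then 1 else 0) *\<^sub>V b) = b'"
    using b by (simp add: if_distrib[of "\<lambda>a. a *\<^sub>V _"] sum.delta cong: if_cong)
  then have "b' - (\<Sum>b\<in>B. (if b = b' then 1 else 0) *\<^sub>V b) \<in> W"
    using subspace_0[OF W] by simp
  then show ?thesis
    using quotient_basis_coeffs_eq[OF W B 1 _ b(1)] by simp
qed

lemma quotient_trace_unique:
  assumes W: "subspace W" and lin: "Vector_Spaces.linear scale scale \<phi>"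
    and \<phi>W: "\<And>w. w \<in> W \<Longrightarrow> \<phi> w \<in> W"
    and B: "quotient_basis V W B" and m: "\<And>b. b \<in> B \<Longrightarrow> \<phi> b - (\<Sum>c\<in>B. m c b *\<^sub>V c) \<in> W"
    and C: "quotient_basis V W C" and n: "\<And>b. b \<in> C \<Longrightarrow> \<phi> b - (\<Sum>c\<in>C. n c b *\<^sub>V c) \<in> W"
  shows "(\<Sum>b\<in>B. m b b) = (\<Sum>c\<in>C. n c c)"
proof -
  interpret phi: Vector_Spaces.linear scale scale \<phi>
    by (fact lin)
  have finB: "finite B" and finC: "finite C"
    using B C by (simp_all add: quotient_basis_def)
  have "\<forall>c\<in>C. \<exists>u. c - (\<Sum>b\<in>B. u b *\<^sub>V b) \<in> W"
    using B C by (auto simp: quotient_basis_def subset_iff)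
  from bchoice[OF this] obtain P' where P': "\<And>c. c \<in> C \<Longrightarrow> c - (\<Sum>b\<in>B. P' c b *\<^sub>V b) \<in> W"
    by blast
  define P where "P b c = P' c b" for b c
  have P: "\<And>c. c \<in> C \<Longrightarrow> c - (\<Sum>b\<in>B. P b c *\<^sub>V b) \<in> W"
    using P' by (simp add: P_def)
  have "\<forall>b\<in>B. \<exists>u. b - (\<Sum>c\<in>C. u c *\<^sub>V c) \<in> W"
    using B C by (auto simp: quotient_basis_def subset_iff)
  from bchoice[OF this] obtain Q' where Q': "\<And>b. b \<in> B \<Longrightarrow> b - (\<Sum>c\<in>C. Q' b c *\<^sub>V c) \<in> W"
    by blast
  define Q where "Q c b = Q' b c" for c b
  have Q: "\<And>b. b \<in> B \<Longrightarrow> b - (\<Sum>c\<in>C. Q c b *\<^sub>V c) \<in> W"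
    using Q' by (simp add: Q_def)
  have PQ: "(\<Sum>c\<in>C. P b c * Q c b') = (if b = b' then 1 else 0)" if "b \<in> B" "b' \<in> B" for b b'
    by (rule change_of_basis_inverse[OF W B P Q that])
  have QP: "(\<Sum>b\<in>B. Q c b * P b c') = (if c = c' then 1 else 0)" if "c \<in> C" "c' \<in> C" for c c'
    by (rule change_of_basis_inverse[OF W C Q P that])
  have mP_Pn: "(\<Sum>b'\<in>B. m b b' * P b' c) = (\<Sum>c'\<in>C. P b c' * n c' c)"
    if b: "b \<in> B" and c: "c \<in> C" for b c
  proof -
    have "\<phi> (c - (\<Sum>b'\<in>B. P b' c *\<^sub>V b')) \<in> W"
      using P[OF c] by (rule \<phi>W)
    then have 1: "\<phi> c - (\<Sum>b'\<in>B. P b' c *\<^sub>V \<phi> b') \<in> W"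
      by (simp add: phi.diff phi.sum phi.scale)
    have "(\<Sum>b'\<in>B. P b' c *\<^sub>V \<phi> b') - (\<Sum>b'\<in>B. P b' c *\<^sub>V (\<Sum>b\<in>B. m b b' *\<^sub>V b)) \<in> W"
      using m by (intro subspace_sum_scale_diff[OF W]) auto
    from subspace_add[OF W 1 this]
    have 2: "\<phi> c - (\<Sum>b\<in>B. (\<Sum>b'\<in>B. m b b' * P b' c) *\<^sub>V b) \<in> W"
      by (simp add: sum_scale_sum_scale)
    have "(\<Sum>c'\<in>C. n c' c *\<^sub>V c') - (\<Sum>c'\<in>C. n c' c *\<^sub>V (\<Sum>b\<in>B. P b c' *\<^sub>V b)) \<in> W"
      using P by (intro subspace_sum_scale_diff[OF W]) auto
    from subspace_add[OF W n[OF c] this]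
    have 3: "\<phi> c - (\<Sum>b\<in>B. (\<Sum>c'\<in>C. P b c' * n c' c) *\<^sub>V b) \<in> W"
      by (simp add: sum_scale_sum_scale)
    show ?thesis
      using quotient_basis_coeffs_eq[OF W B 2 3 b] .
  qed
  have "(\<Sum>b\<in>B. m b b) = (\<Sum>b\<in>B. \<Sum>b'\<in>B. m b b' * (if b' = b then 1 else 0))"
    using finB by (simp add: if_distrib cong: if_cong)
  also have "\<dots> = (\<Sum>b\<in>B. \<Sum>b'\<in>B. m b b' * (\<Sum>c\<in>C. P b' c * Q c b))"
    by (intro sum.cong refl) (simp add: PQ)
  also have "\<dots> = (\<Sum>b\<in>B. \<Sum>c\<in>C. (\<Sum>b'\<in>B. m b b' * P b' c) * Q c b)"
    by (simp add: sum_distrib_left sum_distrib_right mult.assoc sum.swap[of _ C])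
  also have "\<dots> = (\<Sum>b\<in>B. \<Sum>c\<in>C. (\<Sum>c'\<in>C. P b c' * n c' c) * Q c b)"
    by (intro sum.cong refl) (simp add: mP_Pn)
  also have "\<dots> = (\<Sum>b\<in>B. \<Sum>c\<in>C. \<Sum>c'\<in>C. n c' c * (Q c b * P b c'))"
    by (simp add: sum_distrib_left sum_distrib_right mult_ac)
  also have "\<dots> = (\<Sum>c\<in>C. \<Sum>c'\<in>C. n c' c * (\<Sum>b\<in>B. Q c b * P b c'))"
    by (simp add: sum_distrib_left sum.swap[of _ B])
  also have "\<dots> = (\<Sum>c\<in>C. \<Sum>c'\<in>C. n c' c * (if c = c' then 1 else 0))"
    by (intro sum.cong refl) (simp add: QP)
  also have "\<dots> = (\<Sum>c\<in>C. n c c)"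
    using finC by (simp add: if_distrib cong: if_cong)
  finally show ?thesis .
qed

lemma quotient_trace_eqI:
  assumes "subspace W" "Vector_Spaces.linear scale scale \<phi>" "\<And>w. w \<in> W \<Longrightarrow> \<phi> w \<in> W"
    and B: "quotient_basis V W B" and m: "\<And>b. b \<in> B \<Longrightarrow> \<phi> b - (\<Sum>c\<in>B. m c b *\<^sub>V c) \<in> W"
  shows "quotient_trace V W \<phi> = (\<Sum>b\<in>B. m b b)"
  unfolding quotient_trace_def
proof (rule the_equality)
  show "\<exists>B' m'. quotient_basis V W B' \<and> (\<forall>b\<in>B'. \<phi> b - (\<Sum>c\<in>B'. m' c b *\<^sub>V c) \<in> W) \<and>
          (\<Sum>b\<in>B. m b b) = (\<Sum>b\<in>B'. m' b b)"
    using B m by blast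
next
  fix t
  assume "\<exists>B' m'. quotient_basis V W B' \<and> (\<forall>b\<in>B'. \<phi> b - (\<Sum>c\<in>B'. m' c b *\<^sub>V c) \<in> W) \<and>
            t = (\<Sum>b\<in>B'. m' b b)"
  then obtain B' m' where "quotient_basis V W B'" "t = (\<Sum>b\<in>B'. m' b b)"
    "\<And>b. b \<in> B' \<Longrightarrow> \<phi> b - (\<Sum>c\<in>B'. m' c b *\<^sub>V c) \<in> W"
    by blast
  then show "t = (\<Sum>b\<in>B. m b b)"
    using quotient_trace_unique[OF assms(1-3), of V B' m' B m] B m by simp
qed

end


section \<open>Relative singular homology with rational coefficients\<close>

text \<open>
  The library develops singular homology with integer coefficients only. The definitions below are
  \<^const>\<open>singular_chain\<close>, \<^const>\<open>chain_boundary\<close>, \<^const>\<open>chain_map\<close>, \<^const>\<open>singular_relcycle\<close> and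
  \<^const>\<open>singular_relboundary\<close> with rational instead of integer coefficients, so that
  \<open>H\<^sub>p(X, S; \<rat>)\<close> is \<open>rat_relcycles p X S\<close> modulo \<open>rat_relboundaries p X S\<close>.
\<close>

type_synonym 'a rat_chain = "((nat \<Rightarrow> real) \<Rightarrow> 'a) \<Rightarrow>\<^sub>0 rat"

definition rat_cmul :: "rat \<Rightarrow> ('a \<Rightarrow>\<^sub>0 rat) \<Rightarrow> 'a \<Rightarrow>\<^sub>0 rat" where
  "rat_cmul r c = Poly_Mapping.map ((*) r) c"

lemma lookup_rat_cmul [simp]:
  "Poly_Mapping.lookup (rat_cmul r c) x = r * Poly_Mapping.lookup c x"
  by (simp add: rat_cmul_def map.rep_eq when_def)

interpretation rat_chain: vector_space_quotient rat_cmul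
  by unfold_locales (auto intro!: poly_mapping_eqI simp: lookup_add algebra_simps)

definition rat_singular_chains :: "nat \<Rightarrow> 'a topology \<Rightarrow> 'a rat_chain set" where
  "rat_singular_chains p X = {c. Poly_Mapping.keys c \<subseteq> singular_simplex_set p X}"

definition rat_boundary :: "nat \<Rightarrow> 'a rat_chain \<Rightarrow> 'a rat_chain" where
  "rat_boundary p c =
     (if p = 0 then 0 else
      \<Sum>\<sigma>\<in>Poly_Mapping.keys c. rat_cmul (Poly_Mapping.lookup c \<sigma>)
        (\<Sum>k\<le>p. Poly_Mapping.single (singular_face p k \<sigma>) ((- 1) ^ k)))"

definition rat_chain_map :: "nat \<Rightarrow> ('a \<Rightarrow> 'b) \<Rightarrow> 'a rat_chain \<Rightarrow> 'b rat_chain" where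
  "rat_chain_map p f c =
     (\<Sum>\<sigma>\<in>Poly_Mapping.keys c.
        rat_cmul (Poly_Mapping.lookup c \<sigma>) (Poly_Mapping.single (simplex_map p f \<sigma>) 1))"

definition rat_relcycles :: "nat \<Rightarrow> 'a topology \<Rightarrow> 'a set \<Rightarrow> 'a rat_chain set" where
  "rat_relcycles p X S =
     {c \<in> rat_singular_chains p X.
        rat_boundary p c \<in> rat_singular_chains (p - 1) (subtopology X S)}"

definition rat_relboundaries :: "nat \<Rightarrow> 'a topology \<Rightarrow> 'a set \<Rightarrow> 'a rat_chain set" where
  "rat_relboundaries p X S =
     {c. \<exists>d \<in> rat_singular_chains (Suc p) X.
        rat_boundary (Suc p) d - c \<in> rat_singular_chains p (subtopology X S)}"

definition homology_trace :: "nat \<Rightarrow> 'a topology \<Rightarrow> 'a set \<Rightarrow> ('a \<Rightarrow> 'a) \<Rightarrow> rat" where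
  "homology_trace p X S f =
     rat_chain.quotient_trace (rat_relcycles p X S) (rat_relboundaries p X S) (rat_chain_map p f)"

text \<open>
  The sum over all degrees is meant for pairs whose rational homology is finite-dimensional and
  vanishes in large degrees, such as pairs of compact polyhedra: \<^const>\<open>Sum_any\<close> sums the finitely
  many nonzero terms.
\<close>

definition lefschetz_number :: "('a \<Rightarrow> 'a) \<Rightarrow> 'a topology \<Rightarrow> 'a set \<Rightarrow> rat" where
  "lefschetz_number f X S = Sum_any (\<lambda>p. (- 1) ^ p * homology_trace p X S f)"

end

theory Submission
  imports Defs
begin

text \<open>
  The one-point compactification \<open>Z\<close> of \<open>X \ C\<close> receives maps of pairs from \<open>(X, C)\<close> (collapse \<open>C\<close>)
  and, through the conjugacy \<open>h\<close>, from \<open>(Y, D)\<close>, and both \<open>f\<close> and \<open>g\<close> induce the same self-map of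
  \<open>(Z, z0)\<close>. A collapse map induces an isomorphism of relative homology: since \<open>X\<close> and \<open>C\<close> are
  ANRs, the identity of \<open>(X, C)\<close> is homotopic to a map that sends a neighbourhood \<open>U\<close> of \<open>C\<close> into
  \<open>C\<close>, which makes \<open>H(X, C) \<rightarrow> H(Z, z0)\<close> a retract of \<open>H(X, U) \<rightarrow> H(Z, U / C)\<close>, and the latter is an
  isomorphism by excision. Integral isomorphisms become rational ones by clearing denominators.
\<close>

section \<open>Invariance of traces on subquotients\<close>

text \<open>The map induced by \<open>q\<close> on quotients is bijective, so preimages of a basis
  chosen modulo \<open>W'\<close> form a basis upstairs. This pulls finite-dimensionality back along
  \<open>q\<close>.\<close>

lemma quotient_basis_lift:
  fixes s1 :: "'k::field \<Rightarrow> 'b::ab_group_add \<Rightarrow> 'b" and s2 :: "'k \<Rightarrow> 'c::ab_group_add \<Rightarrow> 'c"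
  assumes q: "Vector_Spaces.linear s1 s2 q"
    and V: "module.subspace s1 V" and W: "module.subspace s1 W" and W': "module.subspace s2 W'"
    and qV: "\<And>v. v \<in> V \<Longrightarrow> q v \<in> V'" and qW: "\<And>w. w \<in> W \<Longrightarrow> q w \<in> W'"
    and inj: "\<And>v. v \<in> V \<Longrightarrow> q v \<in> W' \<Longrightarrow> v \<in> W"
    and surj: "\<And>v'. v' \<in> V' \<Longrightarrow> \<exists>v\<in>V. q v - v' \<in> W'"
    and B': "vector_space_quotient.quotient_basis s2 V' W' B'"
  obtains B where "vector_space_quotient.quotient_basis s1 V W B"
proof -
  interpret v1: vector_space_quotient s1
    using q by (simp add: vector_space_quotient_def Vector_Spaces.linear_iff)
  interpret v2: vector_space_quotient s2
    using q by (simp add: vector_space_quotient_def Vector_Spaces.linear_iff)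
  interpret q: Vector_Spaces.linear s1 s2 q by (fact q)
  have fin: "finite B'" and B'V: "B' \<subseteq> V'"
    and ind: "\<And>u b. (\<Sum>b\<in>B'. s2 (u b) b) \<in> W' \<Longrightarrow> b \<in> B' \<Longrightarrow> u b = 0"
    and span: "\<And>v. v \<in> V' \<Longrightarrow> \<exists>u. v - (\<Sum>b\<in>B'. s2 (u b) b) \<in> W'"
    using B' unfolding v2.quotient_basis_def by blast+
  have "\<forall>b\<in>B'. \<exists>v. v \<in> V \<and> q v - b \<in> W'"
    using surj B'V by blast
  then obtain l where l: "\<And>b. b \<in> B' \<Longrightarrow> l b \<in> V" "\<And>b. b \<in> B' \<Longrightarrow> q (l b) - b \<in> W'"
    by metis
  have ql: "q (\<Sum>b\<in>B'. s1 (u b) (l b)) - (\<Sum>b\<in>B'. s2 (u b) b) \<in> W'" for u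
    using v2.subspace_sum_scale_diff[OF W', of B' "\<lambda>b. q (l b)" "\<lambda>b. b" u] l(2)
    by (simp add: q.sum q.scale)
  have ind_l: "u b = 0" if u: "(\<Sum>b\<in>B'. s1 (u b) (l b)) \<in> W" and b: "b \<in> B'" for u b
  proof -
    have "q (\<Sum>b\<in>B'. s1 (u b) (l b))
        - (q (\<Sum>b\<in>B'. s1 (u b) (l b)) - (\<Sum>b\<in>B'. s2 (u b) b)) \<in> W'"
      using v2.subspace_diff[OF W' qW[OF u] ql] .
    then show ?thesis
      using ind[OF _ b, of u] by simp
  qed
  \<comment> \<open>A basis is recorded as a set, so the lifts must be distinct. Two equal lifts
    would give a dependency with coefficients 1 and -1.\<close>
  have inj_l: "inj_on l B'"
  proof (rule inj_onI, rule ccontr)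
    fix b c assume bc: "b \<in> B'" "c \<in> B'" "l b = l c" "b \<noteq> c"
    let ?u = "\<lambda>x. if x = b then 1 else if x = c then - 1 else 0 :: 'k"
    have "(\<Sum>x\<in>B'. s1 (?u x) (l x)) = (\<Sum>x\<in>{b, c}. s1 (?u x) (l x))"
      using fin bc by (intro sum.mono_neutral_right) auto
    also have "\<dots> = 0"
      using bc by simp
    finally show False
      using ind_l[of ?u b] bc v1.subspace_0[OF W] by auto
  qed
  have "v1.quotient_basis V W (l ` B')"
    unfolding v1.quotient_basis_def
  proof (intro conjI allI impI ballI)
    show "finite (l ` B')" "l ` B' \<subseteq> V"
      using fin l(1) by auto
    show "u b = 0" if "(\<Sum>b\<in>l ` B'. s1 (u b) b) \<in> W" "b \<in> l ` B'" for u b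
      using that ind_l[of "u \<circ> l"] inj_l by (auto simp: sum.reindex)
    show "\<exists>u. v - (\<Sum>b\<in>l ` B'. s1 (u b) b) \<in> W" if v: "v \<in> V" for v
    proof -
      obtain u where u: "q v - (\<Sum>b\<in>B'. s2 (u b) b) \<in> W'"
        using span[OF qV[OF v]] by blast
      have "q (v - (\<Sum>b\<in>B'. s1 (u b) (l b))) \<in> W'"
        using v2.subspace_diff[OF W' u ql[of u]] by (simp add: q.diff)
      moreover have "v - (\<Sum>b\<in>B'. s1 (u b) (l b)) \<in> V"
        using v l(1) V by (intro v1.subspace_diff v1.subspace_sum v1.subspace_scale) auto
      ultimately have "v - (\<Sum>b\<in>B'. s1 (u b) (l b)) \<in> W"
        by (intro inj)
      then have "v - (\<Sum>b\<in>l ` B'. s1 ((u \<circ> inv_into B' l) b) b) \<in> W"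
        using inj_l by (simp add: sum.reindex)
      then show ?thesis by blast
    qed
  qed
  then show ?thesis
    by (rule that)
qed

text \<open>
  No finite-dimensionality is needed: if one quotient has no finite basis, then neither has the
  other, and both traces are descriptions of an empty predicate.
\<close>

lemma quotient_trace_cong:
  fixes s1 :: "'k::field \<Rightarrow> 'b::ab_group_add \<Rightarrow> 'b" and s2 :: "'k \<Rightarrow> 'c::ab_group_add \<Rightarrow> 'c"
  assumes q: "Vector_Spaces.linear s1 s2 q"
    and V: "module.subspace s1 V" and W: "module.subspace s1 W" and W': "module.subspace s2 W'"
    and qV: "\<And>v. v \<in> V \<Longrightarrow> q v \<in> V'" and qW: "\<And>w. w \<in> W \<Longrightarrow> q w \<in> W'"
    and inj: "\<And>v. v \<in> V \<Longrightarrow> q v \<in> W' \<Longrightarrow> v \<in> W"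
    and surj: "\<And>v'. v' \<in> V' \<Longrightarrow> \<exists>v\<in>V. q v - v' \<in> W'"
    and \<phi>: "Vector_Spaces.linear s1 s1 \<phi>" and \<phi>': "Vector_Spaces.linear s2 s2 \<phi>'"
    and \<phi>V: "\<And>v. v \<in> V \<Longrightarrow> \<phi> v \<in> V" and \<phi>W: "\<And>w. w \<in> W \<Longrightarrow> \<phi> w \<in> W"
    and \<phi>W': "\<And>w. w \<in> W' \<Longrightarrow> \<phi>' w \<in> W'"
    and comm: "\<And>v. v \<in> V \<Longrightarrow> q (\<phi> v) = \<phi>' (q v)"
  shows "vector_space_quotient.quotient_trace s1 V W \<phi>
       = vector_space_quotient.quotient_trace s2 V' W' \<phi>'"
proof -
  interpret v1: vector_space_quotient s1
    using q by (simp add: vector_space_quotient_def Vector_Spaces.linear_iff)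
  interpret v2: vector_space_quotient s2
    using q by (simp add: vector_space_quotient_def Vector_Spaces.linear_iff)
  interpret q: Vector_Spaces.linear s1 s2 q by (fact q)
  show ?thesis
  proof (cases "\<exists>B. v1.quotient_basis V W B")
    case True
    then obtain B where B: "v1.quotient_basis V W B" ..
    then have fin: "finite B" and BV: "B \<subseteq> V"
      and ind: "\<And>u b. (\<Sum>b\<in>B. s1 (u b) b) \<in> W \<Longrightarrow> b \<in> B \<Longrightarrow> u b = 0"
      and span: "\<And>v. v \<in> V \<Longrightarrow> \<exists>u. v - (\<Sum>b\<in>B. s1 (u b) b) \<in> W"
      unfolding v1.quotient_basis_def by blast+
    have "\<forall>b\<in>B. \<exists>u. \<phi> b - (\<Sum>c\<in>B. s1 (u c) c) \<in> W"
      using BV \<phi>V span by blast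
    then obtain m' where m': "\<And>b. b \<in> B \<Longrightarrow> \<phi> b - (\<Sum>c\<in>B. s1 (m' b c) c) \<in> W"
      using bchoice[of B "\<lambda>b u. \<phi> b - (\<Sum>c\<in>B. s1 (u c) c) \<in> W"] by blast
    \<comment> \<open>The choice principle yields one coefficient family per \<open>b\<close>;
      \<open>quotient_trace\<close> wants these as columns.\<close>
    define m where "m c b = m' b c" for c b
    have m: "\<And>b. b \<in> B \<Longrightarrow> \<phi> b - (\<Sum>c\<in>B. s1 (m c b) c) \<in> W"
      using m' by (simp add: m_def)
    have ind_q: "u b = 0" if u: "(\<Sum>b\<in>B. s2 (u b) (q b)) \<in> W'" and b: "b \<in> B" for u b
    proof (rule ind[OF inj b])
      show "(\<Sum>b\<in>B. s1 (u b) b) \<in> V"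
        using BV V by (intro v1.subspace_sum v1.subspace_scale) auto
      show "q (\<Sum>b\<in>B. s1 (u b) b) \<in> W'"
        using u by (simp add: q.sum q.scale)
    qed
    have inj_q: "inj_on q B"
    proof (rule inj_onI, rule ccontr)
      fix b c assume bc: "b \<in> B" "c \<in> B" "q b = q c" "b \<noteq> c"
      let ?u = "\<lambda>x. if x = b then 1 else if x = c then - 1 else 0 :: 'k"
      have "(\<Sum>x\<in>B. s2 (?u x) (q x)) = (\<Sum>x\<in>{b, c}. s2 (?u x) (q x))"
        using fin bc by (intro sum.mono_neutral_right) auto
      also have "\<dots> = 0"
        using bc by simp
      finally show False
        using ind_q[of ?u b] bc v2.subspace_0[OF W'] by auto
    qed
    have B': "v2.quotient_basis V' W' (q ` B)"
      unfolding v2.quotient_basis_def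
    proof (intro conjI allI impI ballI)
      show "finite (q ` B)" "q ` B \<subseteq> V'"
        using fin BV qV by auto
      show "u b = 0" if "(\<Sum>b\<in>q ` B. s2 (u b) b) \<in> W'" "b \<in> q ` B" for u b
        using that ind_q[of "u \<circ> q"] inj_q by (auto simp: sum.reindex)
      show "\<exists>u. v' - (\<Sum>b\<in>q ` B. s2 (u b) b) \<in> W'" if v': "v' \<in> V'" for v'
      proof -
        obtain v where v: "v \<in> V" "q v - v' \<in> W'"
          using surj[OF v'] by blast
        obtain u where "v - (\<Sum>b\<in>B. s1 (u b) b) \<in> W"
          using span[OF v(1)] by blast
        from v2.subspace_diff[OF W' qW[OF this] v(2)]
        have "v' - (\<Sum>b\<in>B. s2 (u b) (q b)) \<in> W'"
          by (simp add: q.diff q.sum q.scale)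
        then have "v' - (\<Sum>b\<in>q ` B. s2 ((u \<circ> inv_into B q) b) b) \<in> W'"
          using inj_q by (simp add: sum.reindex)
        then show ?thesis by blast
      qed
    qed
    \<comment> \<open>Reindexed along \<open>?r\<close>, the matrix \<open>m\<close> of
      \<open>\<phi>\<close> also represents \<open>\<phi>'\<close> in the basis formed by the images
      under \<open>q\<close>.\<close>
    let ?r = "inv_into B q"
    have "v2.quotient_trace V' W' \<phi>' = (\<Sum>b\<in>q ` B. m (?r b) (?r b))"
    proof (rule v2.quotient_trace_eqI[OF W' \<phi>' \<phi>W' B', of "\<lambda>c b. m (?r c) (?r b)"])
      fix b' assume "b' \<in> q ` B"
      then obtain b where b: "b \<in> B" "b' = q b"
        by blast
      have "q (\<phi> b - (\<Sum>c\<in>B. s1 (m c b) c)) \<in> W'"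
        using qW[OF m[OF b(1)]] .
      then show "\<phi>' b' - (\<Sum>c\<in>q ` B. s2 (m (?r c) (?r b')) c) \<in> W'"
        using b inj_q comm[of b] BV by (auto simp: q.diff q.sum q.scale sum.reindex)
    qed auto
    also have "\<dots> = (\<Sum>b\<in>B. m b b)"
      using inj_q by (simp add: sum.reindex)
    also have "\<dots> = v1.quotient_trace V W \<phi>"
      by (rule v1.quotient_trace_eqI[OF W \<phi> \<phi>W B m, symmetric])
    finally show ?thesis ..
  next
    case False
    have "\<not> (\<exists>B. v2.quotient_basis V' W' B)"
    proof
      assume "\<exists>B. v2.quotient_basis V' W' B"
      then obtain B' where "v2.quotient_basis V' W' B'" ..
      from quotient_basis_lift[OF q V W W' qV qW inj surj this] False show False
        by blast
    qed
    with False show ?thesis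
      unfolding v1.quotient_trace_def v2.quotient_trace_def by simp
  qed
qed

section \<open>Rational chains and integral chains\<close>

text \<open>The rational counterpart of \<open>frag_extend\<close>. Chain maps and boundaries are
  both of this form, so linearity is proved once for both.\<close>

definition rat_extend :: "('a \<Rightarrow> 'b \<Rightarrow>\<^sub>0 rat) \<Rightarrow> ('a \<Rightarrow>\<^sub>0 rat) \<Rightarrow> 'b \<Rightarrow>\<^sub>0 rat" where
  "rat_extend F c = (\<Sum>\<sigma>\<in>Poly_Mapping.keys c. rat_cmul (Poly_Mapping.lookup c \<sigma>) (F \<sigma>))"

text \<open>Coefficients off the support vanish. A common index set is what makes chains with
  different supports comparable.\<close>

lemma rat_extend_superset:
  assumes "finite S" "Poly_Mapping.keys c \<subseteq> S"
  shows "rat_extend F c = (\<Sum>\<sigma>\<in>S. rat_cmul (Poly_Mapping.lookup c \<sigma>) (F \<sigma>))"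
  unfolding rat_extend_def
  using assms by (intro sum.mono_neutral_left) (auto simp: in_keys_iff)

lemma linear_rat_extend: "Vector_Spaces.linear rat_cmul rat_cmul (rat_extend F)"
proof (unfold_locales)
  fix a b :: "'a \<Rightarrow>\<^sub>0 rat" and r :: rat
  let ?S = "Poly_Mapping.keys a \<union> Poly_Mapping.keys b"
  have "rat_extend F (a + b) = (\<Sum>\<sigma>\<in>?S. rat_cmul (Poly_Mapping.lookup (a + b) \<sigma>) (F \<sigma>))"
    using Poly_Mapping.keys_add[of a b] by (intro rat_extend_superset) auto
  also have "\<dots> = rat_extend F a + rat_extend F b"
    by (simp add: rat_extend_superset[of ?S] lookup_add rat_chain.scale_left_distrib sum.distrib)
  finally show "rat_extend F (a + b) = rat_extend F a + rat_extend F b" .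
  have "Poly_Mapping.keys (rat_cmul r a) \<subseteq> Poly_Mapping.keys a"
    by (auto simp: in_keys_iff)
  then show "rat_extend F (rat_cmul r a) = rat_cmul r (rat_extend F a)"
    by (simp add: rat_extend_superset[of "Poly_Mapping.keys a"] rat_chain.scale_sum_right)
qed

lemma rat_chain_map_eq_extend:
  "rat_chain_map p f = rat_extend (\<lambda>\<sigma>. Poly_Mapping.single (simplex_map p f \<sigma>) 1)"
  by (simp add: fun_eq_iff rat_chain_map_def rat_extend_def)

lemma rat_boundary_eq_extend:
  "rat_boundary p = rat_extend
     (\<lambda>\<sigma>. if p = 0 then 0 else \<Sum>k\<le>p. Poly_Mapping.single (singular_face p k \<sigma>) ((- 1) ^ k))"
  by (simp add: fun_eq_iff rat_boundary_def rat_extend_def)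

interpretation rat_chain_map: Vector_Spaces.linear rat_cmul rat_cmul "rat_chain_map p f" for p f
  unfolding rat_chain_map_eq_extend by (rule linear_rat_extend)

interpretation rat_boundary: Vector_Spaces.linear rat_cmul rat_cmul "rat_boundary p" for p
  unfolding rat_boundary_eq_extend by (rule linear_rat_extend)

text \<open>The inclusion of integral chains, along which integral facts are carried over to
  rational chains.\<close>

definition rat_of_frag :: "('a \<Rightarrow>\<^sub>0 int) \<Rightarrow> 'a \<Rightarrow>\<^sub>0 rat" where
  "rat_of_frag = Poly_Mapping.map rat_of_int"

lemma lookup_rat_of_frag [simp]:
  "Poly_Mapping.lookup (rat_of_frag c) x = rat_of_int (Poly_Mapping.lookup c x)"
  by (simp add: rat_of_frag_def map.rep_eq when_def)

lemma keys_rat_of_frag [simp]: "Poly_Mapping.keys (rat_of_frag c) = Poly_Mapping.keys c"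
  by (auto simp: in_keys_iff)

lemma rat_of_frag_add: "rat_of_frag (a + b) = rat_of_frag a + rat_of_frag b"
  by (rule poly_mapping_eqI) (simp add: lookup_add)

lemma rat_of_frag_diff: "rat_of_frag (a - b) = rat_of_frag a - rat_of_frag b"
  by (rule poly_mapping_eqI) (simp add: lookup_minus)

lemma rat_of_frag_cmul: "rat_of_frag (frag_cmul k a) = rat_cmul (of_int k) (rat_of_frag a)"
  by (rule poly_mapping_eqI) simp

lemma rat_of_frag_0 [simp]: "rat_of_frag 0 = 0"
  by (rule poly_mapping_eqI) simp

lemma rat_of_frag_sum: "rat_of_frag (sum f A) = (\<Sum>x\<in>A. rat_of_frag (f x))"
  by (induction A rule: infinite_finite_induct) (simp_all add: rat_of_frag_add)

lemma rat_of_frag_of: "rat_of_frag (frag_of x) = Poly_Mapping.single x 1"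
  by (rule poly_mapping_eqI) (simp add: lookup_single when_def)

lemma rat_of_frag_extend:
  "rat_of_frag (frag_extend F c) = rat_extend (\<lambda>x. rat_of_frag (F x)) (rat_of_frag c)"
  by (simp add: frag_extend_def rat_extend_def rat_of_frag_sum rat_of_frag_cmul)

lemma rat_chain_map_of_frag: "rat_chain_map p f (rat_of_frag c) = rat_of_frag (chain_map p f c)"
  by (simp add: chain_map_def rat_of_frag_extend rat_chain_map_eq_extend rat_of_frag_of)

lemma rat_boundary_of_frag: "rat_boundary p (rat_of_frag c) = rat_of_frag (chain_boundary p c)"
proof (cases "p = 0")
  case False
  \<comment> \<open>The integral boundary carries its sign as a scalar factor, the rational one as
    the coefficient of a single simplex.\<close>
  have "rat_cmul ((- 1) ^ k) (Poly_Mapping.single \<sigma> 1) = Poly_Mapping.single \<sigma> ((- 1) ^ k)"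
    for k and \<sigma> :: "(nat \<Rightarrow> real) \<Rightarrow> 'a"
    by (rule poly_mapping_eqI) (simp add: lookup_single when_def)
  with False show ?thesis
    by (simp add: chain_boundary_def rat_of_frag_extend rat_boundary_eq_extend rat_of_frag_sum
        rat_of_frag_cmul rat_of_frag_of)
qed (simp add: rat_boundary_def chain_boundary_def)

lemma rat_of_frag_in_chains_iff [simp]:
  "rat_of_frag c \<in> rat_singular_chains p X \<longleftrightarrow> singular_chain p X c"
  by (simp add: rat_singular_chains_def singular_chain_def)

lemma rat_cmul_in_chains_iff [simp]:
  "r \<noteq> 0 \<Longrightarrow> rat_cmul r c \<in> rat_singular_chains p X \<longleftrightarrow> c \<in> rat_singular_chains p X"
  by (auto simp: rat_singular_chains_def in_keys_iff subset_iff)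

lemma subspace_rat_singular_chains: "rat_chain.subspace (rat_singular_chains p X)"
proof (rule rat_chain.subspaceI)
  show "x + y \<in> rat_singular_chains p X"
    if "x \<in> rat_singular_chains p X" "y \<in> rat_singular_chains p X" for x y
    using that Poly_Mapping.keys_add[of x y] unfolding rat_singular_chains_def by blast
qed (auto simp: rat_singular_chains_def in_keys_iff subset_iff)

text \<open>The support is finite, so the product of all denominators of coefficients is a suitable
  factor.\<close>

lemma clear_denominators:
  fixes c :: "'a \<Rightarrow>\<^sub>0 rat"
  obtains n :: int and z where "n > 0" "rat_cmul (of_int n) c = rat_of_frag z"
proof -
  define n where "n = (\<Prod>x\<in>Poly_Mapping.keys c. snd (quotient_of (Poly_Mapping.lookup c x)))"
  \<comment> \<open>The floor only names the integer; the product is shown below to be integral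
    already.\<close>
  define w where "w x = \<lfloor>of_int n * Poly_Mapping.lookup c x\<rfloor>" for x
  have n: "n > 0"
    unfolding n_def by (intro prod_pos) (simp add: quotient_of_denom_pos')
  have "of_int n * Poly_Mapping.lookup c x \<in> \<int>" for x
  proof (cases "x \<in> Poly_Mapping.keys c")
    case True
    obtain a b where ab: "quotient_of (Poly_Mapping.lookup c x) = (a, b)"
      by fastforce
    have "b dvd n"
      unfolding n_def using True ab by (metis dvd_prodI finite_keys snd_conv)
    then obtain k where "n = b * k" ..
    moreover have "b > 0" "Poly_Mapping.lookup c x = of_int a / of_int b"
      using ab quotient_of_denom_pos quotient_of_div by blast+
    ultimately have "of_int n * Poly_Mapping.lookup c x = of_int (k * a)"
      by simp
    then show ?thesis
      by (metis Ints_of_int)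
  qed (simp add: in_keys_iff)
  then have w: "of_int n * Poly_Mapping.lookup c x = rat_of_int (w x)" for x
    unfolding w_def by (metis Ints_cases floor_of_int)
  have "{x. w x \<noteq> 0} \<subseteq> Poly_Mapping.keys c"
    by (auto simp: in_keys_iff w_def)
  then have fin: "finite {x. w x \<noteq> 0}"
    by (rule finite_subset) simp
  have "rat_cmul (of_int n) c = rat_of_frag (Abs_poly_mapping w)"
    using fin w by (intro poly_mapping_eqI) simp
  with n show ?thesis
    by (rule that)
qed

text \<open>One factor for both chains, so that a relation such as a boundary equation between them
  survives the scaling.\<close>

lemma clear_denominators2:
  fixes c :: "'a \<Rightarrow>\<^sub>0 rat" and d :: "'b \<Rightarrow>\<^sub>0 rat"
  obtains n :: int and y z where "n > 0"
    "rat_cmul (of_int n) c = rat_of_frag y" "rat_cmul (of_int n) d = rat_of_frag z"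
proof -
  obtain m y where m: "m > 0" "rat_cmul (of_int m) c = rat_of_frag y"
    by (rule clear_denominators)
  obtain k z where k: "k > 0" "rat_cmul (of_int k) d = rat_of_frag z"
    by (rule clear_denominators)
  have "rat_cmul (of_int (m * k)) c = rat_of_frag (frag_cmul k y)"
    by (simp add: rat_of_frag_cmul flip: m(2))
  moreover have "rat_cmul (of_int (m * k)) d = rat_of_frag (frag_cmul m z)"
    by (simp add: rat_of_frag_cmul flip: k(2))
  ultimately show ?thesis
    using that[of "m * k"] m(1) k(1) by simp
qed

section \<open>Rational relative cycles and boundaries\<close>

lemma subspace_rat_relcycles: "rat_chain.subspace (rat_relcycles p X S)"
  using subspace_rat_singular_chains[of p X]
    subspace_rat_singular_chains[of "p - 1" "subtopology X S"]
  unfolding rat_chain.subspace_def rat_relcycles_def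
  by (auto simp: rat_boundary.add rat_boundary.scale)

lemma subspace_rat_relboundaries: "rat_chain.subspace (rat_relboundaries p X S)"
proof (rule rat_chain.subspaceI)
  note C = subspace_rat_singular_chains
  show "0 \<in> rat_relboundaries p X S"
    unfolding rat_relboundaries_def mem_Collect_eq
    using rat_chain.subspace_0[OF C] by (intro bexI[of _ 0]) (simp_all add: rat_boundary.zero)
  show "x + y \<in> rat_relboundaries p X S"
    if "x \<in> rat_relboundaries p X S" "y \<in> rat_relboundaries p X S" for x y
  proof -
    obtain d e where "d \<in> rat_singular_chains (Suc p) X" "e \<in> rat_singular_chains (Suc p) X"
      "rat_boundary (Suc p) d - x \<in> rat_singular_chains p (subtopology X S)"
      "rat_boundary (Suc p) e - y \<in> rat_singular_chains p (subtopology X S)"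
      using \<open>x \<in> _\<close> \<open>y \<in> _\<close> unfolding rat_relboundaries_def by blast
    from rat_chain.subspace_add[OF C this(1,2)] rat_chain.subspace_add[OF C this(3,4)] show ?thesis
      unfolding rat_relboundaries_def mem_Collect_eq
      by (intro bexI[of _ "d + e"]) (simp_all add: rat_boundary.add algebra_simps)
  qed
  show "rat_cmul r x \<in> rat_relboundaries p X S" if "x \<in> rat_relboundaries p X S" for r x
  proof -
    obtain d where "d \<in> rat_singular_chains (Suc p) X"
      "rat_boundary (Suc p) d - x \<in> rat_singular_chains p (subtopology X S)"
      using \<open>x \<in> _\<close> unfolding rat_relboundaries_def by blast
    from rat_chain.subspace_scale[OF C this(1), of r] rat_chain.subspace_scale[OF C this(2), of r]
    show ?thesis
      unfolding rat_relboundaries_def mem_Collect_eq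
      by (intro bexI[of _ "rat_cmul r d"])
        (simp_all add: rat_boundary.scale rat_chain.scale_right_diff_distrib)
  qed
qed

lemma rat_of_frag_in_relcycles_iff [simp]:
  "rat_of_frag z \<in> rat_relcycles p X S \<longleftrightarrow> singular_relcycle p X S z"
  by (simp add: rat_relcycles_def singular_relcycle rat_boundary_of_frag)

lemma rat_of_frag_in_relboundaries:
  assumes "singular_relboundary p X S z"
  shows "rat_of_frag z \<in> rat_relboundaries p X S"
proof -
  obtain d where "singular_chain (Suc p) X d"
    "singular_chain p (subtopology X S) (chain_boundary (Suc p) d - z)"
    using assms unfolding singular_relboundary_def mod_subset_def by auto
  then show ?thesis
    unfolding rat_relboundaries_def
    by (auto intro!: bexI[of _ "rat_of_frag d"] simp: rat_boundary_of_frag simp flip: rat_of_frag_diff)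
qed

lemma rat_cmul_in_subspace_iff:
  assumes "rat_chain.subspace V" "r \<noteq> 0"
  shows "rat_cmul r c \<in> V \<longleftrightarrow> c \<in> V"
proof
  assume "rat_cmul r c \<in> V"
  from rat_chain.subspace_scale[OF assms(1) this, of "inverse r"] assms(2) show "c \<in> V"
    by simp
qed (simp add: assms(1) rat_chain.subspace_scale)

lemma rat_relcycles_clear_denominators:
  assumes "c \<in> rat_relcycles p X S"
  obtains n :: int and z where "n > 0" "rat_cmul (of_int n) c = rat_of_frag z"
    "singular_relcycle p X S z"
proof -
  obtain n z where nz: "n > 0" "rat_cmul (of_int n) c = rat_of_frag z"
    by (rule clear_denominators)
  have "rat_of_frag z \<in> rat_relcycles p X S"
    unfolding nz(2)[symmetric] using assms by (rule rat_chain.subspace_scale[OF subspace_rat_relcycles])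
  with nz that show ?thesis
    by simp
qed

lemma rat_relboundaries_clear_denominators:
  assumes "c \<in> rat_relboundaries p X S"
  obtains n :: int and z where "n > 0" "rat_cmul (of_int n) c = rat_of_frag z"
    "singular_relboundary p X S z"
proof -
  obtain d where d: "d \<in> rat_singular_chains (Suc p) X"
    "rat_boundary (Suc p) d - c \<in> rat_singular_chains p (subtopology X S)"
    using assms by (auto simp: rat_relboundaries_def)
  obtain n z e where n: "n > 0"
    and z: "rat_cmul (of_int n) c = rat_of_frag z" and e: "rat_cmul (of_int n) d = rat_of_frag e"
    by (rule clear_denominators2)
  have "rat_of_frag e \<in> rat_singular_chains (Suc p) X"
    using n d(1) by (simp flip: e)
  moreover have "rat_of_frag (chain_boundary (Suc p) e - z) =
      rat_cmul (of_int n) (rat_boundary (Suc p) d - c)"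
    by (simp add: rat_of_frag_diff rat_chain.scale_right_diff_distrib rat_boundary.scale
        flip: z e rat_boundary_of_frag)
  then have "rat_of_frag (chain_boundary (Suc p) e - z) \<in> rat_singular_chains p (subtopology X S)"
    using n d(2) by simp
  ultimately have "singular_relboundary p X S z"
    unfolding singular_relboundary_def mod_subset_def by auto
  with n z that show ?thesis
    by simp
qed

text \<open>Scale to an integral chain, apply the integral fact, and divide by the nonzero factor.
  The two lemmas that follow use the same scheme.\<close>

lemma rat_chain_map_relcycles:
  assumes "c \<in> rat_relcycles p X S" "continuous_map X Y f" "f \<in> S \<rightarrow> T"
  shows "rat_chain_map p f c \<in> rat_relcycles p Y T"
proof -
  obtain n z where n: "n > 0" and z: "rat_cmul (of_int n) c = rat_of_frag z"
    and "singular_relcycle p X S z"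
    using assms(1) by (rule rat_relcycles_clear_denominators)
  then have "rat_of_frag (chain_map p f z) \<in> rat_relcycles p Y T"
    using assms singular_relcycle_chain_map by simp
  then show ?thesis
    using n by (simp add: rat_chain_map.scale rat_cmul_in_subspace_iff subspace_rat_relcycles
        flip: rat_chain_map_of_frag z)
qed

lemma rat_chain_map_relboundaries:
  assumes "c \<in> rat_relboundaries p X S" "continuous_map X Y f" "f \<in> S \<rightarrow> T"
  shows "rat_chain_map p f c \<in> rat_relboundaries p Y T"
proof -
  obtain n z where n: "n > 0" and z: "rat_cmul (of_int n) c = rat_of_frag z"
    and "singular_relboundary p X S z"
    using assms(1) by (rule rat_relboundaries_clear_denominators)
  then have "rat_of_frag (chain_map p f z) \<in> rat_relboundaries p Y T"
    using assms singular_relboundary_chain_map rat_of_frag_in_relboundaries by blast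
  then show ?thesis
    using n by (simp add: rat_chain_map.scale rat_cmul_in_subspace_iff subspace_rat_relboundaries
        flip: rat_chain_map_of_frag z)
qed

lemma rat_chain_map_commute:
  assumes c: "c \<in> rat_singular_chains p X"
    and comm: "\<And>x. x \<in> topspace X \<Longrightarrow> k (f x) = f' (k x)"
  shows "rat_chain_map p k (rat_chain_map p f c) = rat_chain_map p f' (rat_chain_map p k c)"
proof -
  obtain n z where n: "n > 0" and z: "rat_cmul (of_int n) c = rat_of_frag z"
    by (rule clear_denominators)
  have "rat_of_frag z \<in> rat_singular_chains p X"
    using n c by (simp flip: z)
  then have "chain_map p (k \<circ> f) z = chain_map p (f' \<circ> k) z"
    using comm by (intro chain_map_eq[of p X]) auto
  then have "rat_chain_map p k (rat_chain_map p f (rat_of_frag z)) =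
      rat_chain_map p f' (rat_chain_map p k (rat_of_frag z))"
    by (simp add: rat_chain_map_of_frag chain_map_compose)
  then show ?thesis
    using n by (simp add: rat_chain_map.scale flip: z)
qed

text \<open>Bijectivity on integral homology is unfolded into statements about chains modulo
  boundaries. These survive clearing denominators and are then the hypotheses of
  \<open>quotient_trace_cong\<close>.\<close>

lemma homology_trace_eqI:
  assumes q: "continuous_map X Z q" "q \<in> S \<rightarrow> T"
    and iso: "hom_induced (int p) X S Z T q
        \<in> iso (relative_homology_group (int p) X S) (relative_homology_group (int p) Z T)"
    and f: "continuous_map X X f" "f \<in> S \<rightarrow> S" and f': "continuous_map Z Z f'" "f' \<in> T \<rightarrow> T"
    and comm: "\<And>x. x \<in> topspace X \<Longrightarrow> q (f x) = f' (q x)"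
  shows "homology_trace p X S f = homology_trace p Z T f'"
proof -
  let ?q = "hom_induced (int p) X S Z T q"
  have bij: "bij_betw ?q (homologous_rel_set p X S ` singular_relcycle_set p X S)
      (homologous_rel_set p Z T ` singular_relcycle_set p Z T)"
    using iso by (simp add: iso_def carrier_relative_homology_group)
  have inj: "singular_relboundary p X S z"
    if z: "singular_relcycle p X S z" and qz: "singular_relboundary p Z T (chain_map p q z)" for z
  proof -
    have "?q (homologous_rel_set p X S z) = ?q (homologous_rel_set p X S 0)"
    proof -
      have "homologous_rel p Z T (chain_map p q z) (chain_map p q 0)"
        using qz by (simp add: homologous_rel_def)
      then show ?thesis
        using z q by (simp only: hom_induced_chain_map singular_relcycle_0 homologous_rel_set_eq)
    qed
    then have "homologous_rel_set p X S z = homologous_rel_set p X S 0"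
      using z by (intro inj_onD[OF bij_betw_imp_inj_on[OF bij]]) auto
    then have "homologous_rel p X S z 0"
      by (simp only: homologous_rel_set_eq)
    then show ?thesis
      by (simp add: homologous_rel_def)
  qed
  have surj: "\<exists>x. singular_relcycle p X S x \<and> singular_relboundary p Z T (chain_map p q x - z)"
    if z: "singular_relcycle p Z T z" for z
  proof -
    have "homologous_rel_set p Z T z \<in> ?q ` homologous_rel_set p X S ` singular_relcycle_set p X S"
      using bij z by (simp add: bij_betw_def)
    then obtain x where x: "singular_relcycle p X S x"
      "?q (homologous_rel_set p X S x) = homologous_rel_set p Z T z"
      by (elim imageE) (simp only: mem_Collect_eq)
    then have "homologous_rel_set p Z T (chain_map p q x) = homologous_rel_set p Z T z"
      using q by (simp add: hom_induced_chain_map)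
    then have "homologous_rel p Z T (chain_map p q x) z"
      by (simp only: homologous_rel_set_eq)
    then show ?thesis
      using x(1) by (auto simp: homologous_rel_def)
  qed
  have inj': "c \<in> rat_relboundaries p X S"
    if c: "c \<in> rat_relcycles p X S" "rat_chain_map p q c \<in> rat_relboundaries p Z T" for c
  proof -
    obtain n z where n: "n > 0" and z: "rat_cmul (of_int n) c = rat_of_frag z"
      and zc: "singular_relcycle p X S z"
      using c(1) by (rule rat_relcycles_clear_denominators)
    obtain m y where m: "m > 0" and y: "rat_cmul (of_int m) (rat_chain_map p q c) = rat_of_frag y"
      and yb: "singular_relboundary p Z T y"
      using c(2) by (rule rat_relboundaries_clear_denominators)
    have mz: "rat_of_frag (frag_cmul m z) = rat_cmul (of_int (m * n)) c"
      by (simp add: rat_of_frag_cmul flip: z)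
    \<comment> \<open>Both sides are \<open>m * n\<close> times the image of \<open>c\<close>:
      \<open>n\<close> clears the denominators of \<open>c\<close>, and \<open>m\<close> those of
      its image.\<close>
    have "rat_of_frag (chain_map p q (frag_cmul m z)) = rat_of_frag (frag_cmul n y)"
      by (simp add: rat_of_frag_cmul rat_chain_map.scale mult.commute
          flip: rat_chain_map_of_frag y z)
    then have "chain_map p q (frag_cmul m z) = frag_cmul n y"
      by (metis lookup_rat_of_frag of_int_eq_iff poly_mapping_eqI)
    then have "singular_relboundary p X S (frag_cmul m z)"
      using inj[of "frag_cmul m z"] zc yb
      by (metis singular_relboundary_cmul singular_relcycle_cmul)
    then have "rat_cmul (of_int (m * n)) c \<in> rat_relboundaries p X S"
      unfolding mz[symmetric] by (rule rat_of_frag_in_relboundaries)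
    then show ?thesis
      using m n by (simp add: rat_cmul_in_subspace_iff[OF subspace_rat_relboundaries])
  qed
  have surj': "\<exists>x\<in>rat_relcycles p X S. rat_chain_map p q x - c \<in> rat_relboundaries p Z T"
    if c: "c \<in> rat_relcycles p Z T" for c
  proof -
    obtain n z where n: "n > 0" and z: "rat_cmul (of_int n) c = rat_of_frag z"
      and zc: "singular_relcycle p Z T z"
      using c(1) by (rule rat_relcycles_clear_denominators)
    obtain x where x: "singular_relcycle p X S x"
      "singular_relboundary p Z T (chain_map p q x - z)"
      using surj[OF zc] by blast
    \<comment> \<open>Division by \<open>n\<close> turns an integral preimage of the scaled cycle
      into a rational preimage of \<open>c\<close>.\<close>
    let ?x = "rat_cmul (inverse (of_int n)) (rat_of_frag x)"
    have "?x \<in> rat_relcycles p X S"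
      using x(1) by (intro rat_chain.subspace_scale[OF subspace_rat_relcycles]) simp
    moreover have "rat_cmul (inverse (of_int n)) (rat_of_frag (chain_map p q x - z))
        \<in> rat_relboundaries p Z T"
      using x(2)
      by (intro rat_chain.subspace_scale[OF subspace_rat_relboundaries] rat_of_frag_in_relboundaries)
    then have "rat_chain_map p q ?x - c \<in> rat_relboundaries p Z T"
      using n by (simp add: rat_of_frag_diff rat_chain_map.scale rat_chain.scale_right_diff_distrib
          rat_chain_map_of_frag flip: z)
    ultimately show ?thesis ..
  qed
  show ?thesis
    unfolding homology_trace_def
  proof (rule quotient_trace_cong[where q = "rat_chain_map p q"])
    show "rat_chain_map p q (rat_chain_map p f c) = rat_chain_map p f' (rat_chain_map p q c)"
      if "c \<in> rat_relcycles p X S" for c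
      using that comm by (intro rat_chain_map_commute[of c p X]) (simp_all add: rat_relcycles_def)
  qed (fact subspace_rat_relcycles subspace_rat_relboundaries rat_chain_map.linear_axioms inj' surj'
        | erule rat_chain_map_relcycles[OF _ q] rat_chain_map_relboundaries[OF _ q]
          rat_chain_map_relcycles[OF _ f] rat_chain_map_relboundaries[OF _ f]
          rat_chain_map_relboundaries[OF _ f'])+
qed

section \<open>Collapsing a subcomplex\<close>

text \<open>
  The retraction of a neighbourhood onto \<open>C\<close> is homotopic to the identity near \<open>C\<close> because \<open>X\<close> is
  an ANR; the cutoff \<open>\<nu>\<close> slows the homotopy down to a stop away from \<open>C\<close>.
\<close>

lemma ANR_pair_deformation:
  fixes X C :: "'a::euclidean_space set"
  assumes "ANR X" "ANR C" and clo: "closedin (top_of_set X) C"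
  obtains U and G :: "real \<times> 'a \<Rightarrow> 'a" where
    "openin (top_of_set X) U" "C \<subseteq> U"
    "continuous_on ({0..1} \<times> X) G" "G \<in> {0..1} \<times> X \<rightarrow> X"
    "\<And>x. x \<in> X \<Longrightarrow> G (0, x) = x" "\<And>t c. t \<in> {0..1} \<Longrightarrow> c \<in> C \<Longrightarrow> G (t, c) = c"
    "\<And>x. x \<in> U \<Longrightarrow> G (1, x) \<in> C"
proof -
  obtain V where opV: "openin (top_of_set X) V" and "C retract_of V"
    using ANR_imp_neighbourhood_retract[OF \<open>ANR C\<close> clo] .
  then obtain r where CV: "C \<subseteq> V" and contr: "continuous_on V r"
    and rV: "\<And>x. x \<in> V \<Longrightarrow> r x \<in> C" and rC: "\<And>x. x \<in> C \<Longrightarrow> r x = x"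
    by (auto simp: retract_of_def retraction_def)
  have VX: "V \<subseteq> X"
    using opV openin_imp_subset by blast
  have cloV: "closedin (top_of_set V) C"
    using clo CV VX by (rule closedin_subset_trans)
  \<comment> \<open>The prescribed part of the homotopy: identity at time 0, the retraction
    \<open>r\<close> at time 1, and stationary on \<open>C\<close>.\<close>
  define h where "h z = (if fst z = 1 then r (snd z) else snd z)" for z :: "real \<times> 'a"
  let ?bot = "{0::real} \<times> V" and ?top = "{1::real} \<times> V" and ?E = "{0, 1::real} \<times> V \<union> {0..1} \<times> C"
  have clo0: "closedin (top_of_set ({0..1} \<times> V)) ?bot"
    and clo1: "closedin (top_of_set ({0..1} \<times> V)) ?top"
    and cloC: "closedin (top_of_set ({0..1::real} \<times> V)) ({0..1} \<times> C)"
    by (auto intro!: closedin_Times cloV simp: closed_subset)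
  have "continuous_on (?top \<union> (?bot \<union> {0..1} \<times> C)) h"
    unfolding h_def
  proof (rule continuous_on_cases_local)
    show "closedin (top_of_set (?top \<union> (?bot \<union> {0..1} \<times> C))) ?top"
      by (rule closedin_subset_trans[OF clo1]) (use CV in auto)
    show "closedin (top_of_set (?top \<union> (?bot \<union> {0..1} \<times> C))) (?bot \<union> {0..1} \<times> C)"
      by (rule closedin_subset_trans[OF closedin_Un[OF clo0 cloC]]) (use CV in auto)
    show "continuous_on ?top (\<lambda>x. r (snd x))"
      by (intro continuous_intros continuous_on_compose2[OF contr]) auto
    show "continuous_on (?bot \<union> {0..1} \<times> C) snd"
      by (intro continuous_intros)
    show "r (snd x) = snd x"
      if "x \<in> ?top \<and> fst x \<noteq> 1 \<or> x \<in> ?bot \<union> {0..1} \<times> C \<and> fst x = 1" for x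
      using that rC by auto
  qed
  moreover have S: "?top \<union> (?bot \<union> {0..1} \<times> C) = ?E"
    by auto
  ultimately have cont_h: "continuous_on ?E h"
    by simp
  have h_in: "h \<in> ?E \<rightarrow> X"
    using VX CV rV unfolding h_def by (auto simp: subset_iff)
  have cloS: "closedin (top_of_set ({0..1::real} \<times> V)) ?E"
    using closedin_Un[OF clo1 closedin_Un[OF clo0 cloC]] by (simp only: S)
  \<comment> \<open>As \<open>X\<close> is an ANR, \<open>h\<close> extends over a neighbourhood of
    its closed domain in \<open>{0..1} \<times> V\<close>.\<close>
  obtain W k where W: "?E \<subseteq> W" and opW: "openin (top_of_set ({0..1} \<times> V)) W"
    and contk: "continuous_on W k" and kW: "k \<in> W \<rightarrow> X" and kh: "\<And>z. z \<in> ?E \<Longrightarrow> k z = h z"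
    using ANR_imp_absolute_neighbourhood_extensor[OF \<open>ANR X\<close> cont_h h_in cloS] by blast
  \<comment> \<open>By compactness of the unit interval, the neighbourhood \<open>W\<close> contains
    a whole tube around \<open>C\<close>.\<close>
  obtain O' where opO: "openin (top_of_set V) O'" and "C \<subseteq> O'" and OW: "{0..1} \<times> O' \<subseteq> W"
    using Retracts.tube_lemma_gen[of "{0..1::real}" C V W] W CV opW by auto
  have OV: "O' \<subseteq> V"
    using opO openin_imp_subset by blast
  have "closedin (top_of_set X) (X - O')"
    using openin_trans[OF opO opV] by (simp add: openin_closedin_eq)
  moreover have "C \<inter> (X - O') = {}"
    using \<open>C \<subseteq> O'\<close> by blast
  ultimately obtain \<mu> :: "'a \<Rightarrow> real" where cont\<mu>: "continuous_on X \<mu>"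
    and \<mu>C: "\<And>x. x \<in> C \<Longrightarrow> \<mu> x = 1" and \<mu>O: "\<And>x. x \<in> X - O' \<Longrightarrow> \<mu> x = 0"
    using Urysohn_local[OF clo, of "X - O'" 1 0] by metis
  \<comment> \<open>The value is 0 where \<open>\<mu>\<close> is at most 1/3 and 1 where it is at
    least 2/3.\<close>
  define \<nu> where "\<nu> x = max 0 (min 1 (3 * \<mu> x - 1))" for x
  have cont\<nu>: "continuous_on X \<nu>"
    unfolding \<nu>_def by (intro continuous_intros cont\<mu>)
  have \<nu>01: "t * \<nu> x \<in> {0..1}" if "t \<in> {0..1}" for t x
    using that by (auto simp: \<nu>_def mult_le_one)
  \<comment> \<open>The branches agree where \<open>\<mu>\<close> is 1/3, since \<open>k\<close>
    starts at the identity. Where \<open>\<mu>\<close> is larger, the point lies in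
    \<open>O'\<close>, so \<open>k\<close> is under control there.\<close>
  define G where "G z = (if \<mu> (snd z) \<le> 1/3 then snd z else k (fst z * \<nu> (snd z), snd z))" for z
  have inO: "x \<in> O'" if "x \<in> X" "1/3 \<le> \<mu> x" for x
    using that \<mu>O[of x] by force
  have kX: "k (s, x) \<in> X" if "s \<in> {0..1}" "x \<in> O'" for s x
    using that OW kW by blast
  have k0: "k (0, x) = x" if "x \<in> V" for x
    using kh[of "(0, x)"] that by (simp add: h_def)
  show ?thesis
  proof (rule that[of "{x \<in> X. \<mu> x > 2/3}" G])
    have "openin (top_of_set X) (X \<inter> \<mu> -` {2/3<..})"
      by (intro continuous_openin_preimage_gen cont\<mu>) auto
    then show "openin (top_of_set X) {x \<in> X. \<mu> x > 2/3}"
      by (simp add: Int_def vimage_def)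
    show "C \<subseteq> {x \<in> X. \<mu> x > 2/3}"
      using \<mu>C CV VX by auto
    show "continuous_on ({0..1} \<times> X) G"
      unfolding G_def
    proof (rule continuous_on_cases_le)
      show "continuous_on ({0..1} \<times> X) (\<lambda>z. \<mu> (snd z))"
        by (intro continuous_intros continuous_on_compose2[OF cont\<mu>]) auto
      show "continuous_on {z \<in> {0..1} \<times> X. 1/3 \<le> \<mu> (snd z)}
              (\<lambda>z. k (fst z * \<nu> (snd z), snd z))"
        using inO \<nu>01 OW
        by (intro continuous_on_compose2[OF contk] continuous_intros
            continuous_on_compose2[OF cont\<nu>]) force+
      show "snd z = k (fst z * \<nu> (snd z), snd z)"
        if "z \<in> {0..1} \<times> X" "\<mu> (snd z) = 1/3" for z
        using that inO[of "snd z"] OV k0 by (auto simp: \<nu>_def)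
    qed (intro continuous_intros)
    show "G \<in> {0..1} \<times> X \<rightarrow> X"
    proof clarify
      fix t x assume "(t::real) \<in> {0..1}" "x \<in> X"
      then show "G (t, x) \<in> X"
        using kX[OF \<nu>01[of t x] inO[of x]] by (simp add: G_def)
    qed
    show "G (0, x) = x" if "x \<in> X" for x
      using that inO[of x] OV k0 by (auto simp: G_def)
    show "G (t, c) = c" if "t \<in> {0..1}" "c \<in> C" for t c
      using that kh[of "(t, c)"] rC \<mu>C by (simp add: G_def \<nu>_def h_def)
    show "G (1, x) \<in> C" if "x \<in> {x \<in> X. \<mu> x > 2/3}" for x
    proof -
      have "x \<in> V"
        using that inO[of x] OV by auto
      then show ?thesis
        using that kh[of "(1, x)"] rV by (simp add: G_def \<nu>_def h_def)
    qed
  qed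
qed

text \<open>An abstract model of the quotient map from \<open>X\<close> to \<open>X / C\<close>,
  kept free of a particular construction so that one \<open>Z\<close> can serve two pairs. The
  inclusion in \<open>q_C\<close> admits empty \<open>C\<close>.\<close>

locale collapse =
  fixes X C :: "'a::t2_space set" and Z :: "'c::t2_space set" and z0 :: 'c and q :: "'a \<Rightarrow> 'c"
  assumes compact_X: "compact X" and compact_C: "compact C" and C_subset: "C \<subseteq> X"
    and z0_in: "z0 \<in> Z" and cont_q: "continuous_on X q" and q_C: "q ` C \<subseteq> {z0}"
    and bij_q: "bij_betw q (X - C) (Z - {z0})"
begin

text \<open>An inverse of \<open>q\<close> away from the base point; arguments equal to
  \<open>z0\<close> are treated separately.\<close>

definition q_inv :: "'c \<Rightarrow> 'a" where "q_inv = inv_into (X - C) q"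

section \<open>Pointwise behaviour and topology of a collapse map\<close>

lemma q_in: "x \<in> X \<Longrightarrow> q x \<in> Z"
  using bij_q q_C z0_in by (cases "x \<in> C") (auto simp: bij_betw_def)

lemma q_eq_z0_iff: "x \<in> X \<Longrightarrow> q x = z0 \<longleftrightarrow> x \<in> C"
  using bij_q q_C by (cases "x \<in> C") (auto simp: bij_betw_def)

lemma q_eqD: "x \<in> X \<Longrightarrow> y \<in> X \<Longrightarrow> q x = q y \<Longrightarrow> x \<notin> C \<Longrightarrow> x = y"
  using bij_q q_eq_z0_iff[of x] q_eq_z0_iff[of y] by (auto simp: bij_betw_def inj_on_def)

lemma q_inv_q: "x \<in> X \<Longrightarrow> x \<notin> C \<Longrightarrow> q_inv (q x) = x"
  using bij_q by (simp add: q_inv_def bij_betw_def inv_into_f_f)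

lemma q_inv_in: "z \<in> Z \<Longrightarrow> z \<noteq> z0 \<Longrightarrow> q_inv z \<in> X - C"
  using bij_q unfolding q_inv_def by (metis Diff_iff bij_betw_def inv_into_into singletonD)

lemma q_q_inv: "z \<in> Z \<Longrightarrow> z \<noteq> z0 \<Longrightarrow> q (q_inv z) = z"
  using bij_q unfolding q_inv_def by (metis Diff_iff bij_betw_inv_into_right singletonD)

text \<open>For empty \<open>C\<close> the image of \<open>q\<close> misses \<open>z0\<close>, hence
  the \<open>insert\<close>.\<close>

lemma Z_eq: "Z = insert z0 (q ` X)"
  using q_in z0_in q_q_inv q_inv_in by (force simp: image_iff)

lemma compact_Z: "compact Z"
  unfolding Z_eq using compact_X cont_q by (intro compact_insert compact_continuous_image)

lemma closed_image: "closedin (top_of_set X) A \<Longrightarrow> closed (q ` A)"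
  by (meson closedin_compact closedin_imp_subset compact_X compact_continuous_image
      compact_imp_closed cont_q continuous_on_subset)

text \<open>
  Stated with the explicit condition at \<open>z0\<close> so that it covers the case \<open>C = {}\<close>, in which \<open>z0\<close> is
  an isolated point outside the image of \<open>q\<close>.
\<close>

lemma continuous_on_collapse:
  fixes F :: "real \<times> 'c \<Rightarrow> 'd::topological_space"
  assumes T: "compact T" and cont: "continuous_on (T \<times> X) (\<lambda>(t, x). F (t, q x))"
    and F0: "\<And>t. t \<in> T \<Longrightarrow> F (t, z0) = w"
  shows "continuous_on (T \<times> Z) F"
proof -
  have "closed (T \<times> Z)" "compact (T \<times> X)"
    using T compact_Z compact_X by (auto intro: closed_Times compact_imp_closed compact_Times)
  moreover have "closed (F -` B \<inter> T \<times> Z)" if B: "closed B" for B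
  proof -
    let ?m = "\<lambda>(t, x). (t, q x)" and ?A = "(\<lambda>(t, x). F (t, q x)) -` B \<inter> T \<times> X"
    have "closed ?A"
      using cont B \<open>compact (T \<times> X)\<close> by (subst (asm) continuous_on_closed_vimage)
        (auto intro: compact_imp_closed)
    then have "compact ?A"
      using \<open>compact (T \<times> X)\<close> compact_Int_closed[of "T \<times> X" ?A] by (simp add: Int_ac)
    moreover have "continuous_on ?A ?m"
      unfolding case_prod_unfold
      by (intro continuous_intros continuous_on_compose2[OF cont_q]) auto
    ultimately have "closed (?m ` ?A)"
      by (intro compact_imp_closed compact_continuous_image)
    \<comment> \<open>A preimage in \<open>T \<times> Z\<close> is the compact image of one
      upstairs, together with the slice over \<open>z0\<close>. On that slice \<open>F\<close> is
      constantly \<open>w\<close>, so it is taken entirely or not at all.\<close>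
    moreover have "F -` B \<inter> T \<times> Z = ?m ` ?A \<union> (if w \<in> B then T \<times> {z0} else {})"
    proof (intro equalityI subsetI)
      fix y assume y: "y \<in> F -` B \<inter> T \<times> Z"
      obtain t z where tz: "y = (t, z)" by fastforce
      show "y \<in> ?m ` ?A \<union> (if w \<in> B then T \<times> {z0} else {})"
      proof (cases "z = z0")
        case False
        then have "(t, q_inv z) \<in> ?A" "y = ?m (t, q_inv z)"
          using y tz q_inv_in[of z] q_q_inv[of z] by auto
        then show ?thesis by blast
      qed (use y tz F0 in auto)
    qed (use F0 q_in z0_in in \<open>auto split: if_splits\<close>)
    moreover have "closed (T \<times> {z0})"
      using T by (intro closed_Times compact_imp_closed) auto
    ultimately show ?thesis
      by auto
  qed
  ultimately show ?thesis
    by (simp add: continuous_on_closed_vimage)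
qed

text \<open>A closed subset of \<open>X - C\<close> is the trace of a compact subset of
  \<open>X\<close>, whose image is closed. Hence the restricted bijection is a closed map.\<close>

lemma homeomorphism_complement: "homeomorphism (X - C) (Z - {z0}) q q_inv"
proof -
  have cont: "continuous_on (X - C) q"
    using cont_q by (rule continuous_on_subset) auto
  have clo: "closedin (top_of_set (Z - {z0})) (q ` A)" if "closedin (top_of_set (X - C)) A" for A
  proof -
    obtain K where K: "closed K" "A = (X - C) \<inter> K"
      using \<open>closedin _ A\<close> by (auto simp: closedin_closed)
    then have "q ` A = (Z - {z0}) \<inter> q ` (X \<inter> K)"
      using q_eq_z0_iff q_in by (auto simp: image_iff)
    moreover have "closed (q ` (X \<inter> K))"
      using K(1) by (intro closed_image closedin_closed_Int)
    ultimately show ?thesis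
      by (metis closedin_closed_Int)
  qed
  obtain r' where r': "homeomorphism (X - C) (Z - {z0}) q r'"
    using homeomorphism_injective_closed_map[OF cont _ _ clo] bij_q unfolding bij_betw_def by metis
  have "r' z = q_inv z" if "z \<in> Z - {z0}" for z
    using that r' q_inv_q[of "r' z"] unfolding homeomorphism_def by (metis Diff_iff imageI)
  then show ?thesis
    by (intro homeomorphism_cong[OF r']) auto
qed


text \<open>The end map of \<open>G\<close> carries \<open>(X, U)\<close> to \<open>(X, C)\<close>
  and induces the identity on the homology of \<open>(X, C)\<close>. The same holds after descending
  to \<open>Z\<close>, so bijectivity passes from the pairs with \<open>U\<close> and
  \<open>W\<close> to those with \<open>C\<close> and \<open>z0\<close>.\<close>

lemma iso_relative_homology:
  assumes U: "openin (top_of_set X) U" "C \<subseteq> U"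
    and G: "continuous_on ({0..1} \<times> X) G" "G \<in> {0..1} \<times> X \<rightarrow> X"
    and G0: "\<And>x. x \<in> X \<Longrightarrow> G (0::real, x) = x"
    and GC: "\<And>t c. t \<in> {0..1} \<Longrightarrow> c \<in> C \<Longrightarrow> G (t, c) \<in> C"
    and G1: "\<And>x. x \<in> U \<Longrightarrow> G (1, x) \<in> C"
  shows "hom_induced p (top_of_set X) C (top_of_set Z) {z0} q
    \<in> iso (relative_homology_group p (top_of_set X) C)
          (relative_homology_group p (top_of_set Z) {z0})"
proof -
  \<comment> \<open>This is the image of \<open>U\<close> together with the base point; as the
    complement of the image of a closed set it is visibly open.\<close>
  define W where "W = Z - q ` (X - U)"
  \<comment> \<open>The homotopy descended to \<open>Z\<close>; it is compatible with
    \<open>q\<close> because \<open>G\<close> keeps \<open>C\<close> inside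
    \<open>C\<close>.\<close>
  define G' where "G' y = (if snd y = z0 then z0 else q (G (fst y, q_inv (snd y))))" for y
  let ?\<phi> = "\<lambda>x. G (1, x)" and ?\<phi>' = "\<lambda>z. G' (1, z)"
  have UX: "U \<subseteq> X"
    using U openin_imp_subset by blast
  have GX: "G (t, x) \<in> X" if "t \<in> {0..1}" "x \<in> X" for t x
    using G(2) that by blast
  have q_in_W_iff: "q x \<in> W \<longleftrightarrow> x \<in> U" if "x \<in> X" for x
  proof
    assume "x \<in> U"
    have "q x \<noteq> q y" if "y \<in> X - U" for y
      using that \<open>x \<in> U\<close> \<open>x \<in> X\<close> U(2) q_eqD[of y x] by (metis DiffD1 DiffD2 subsetD)
    then show "q x \<in> W"
      using q_in[OF \<open>x \<in> X\<close>] by (auto simp: W_def)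
  qed (use that in \<open>auto simp: W_def\<close>)
  have z0W: "z0 \<in> W"
    using z0_in q_eq_z0_iff U(2) by (force simp: W_def)
  have "closedin (top_of_set X) (X - U)"
    using U by (simp add: openin_closedin_eq)
  then have "closed (q ` (X - U))"
    by (rule closed_image)
  then have "openin (top_of_set Z) (Z \<inter> - q ` (X - U))"
    by (intro openin_open_Int open_Compl)
  then have opW: "openin (top_of_set Z) W"
    by (simp add: W_def Diff_eq)
  have G'q: "G' (t, q x) = q (G (t, x))" if "t \<in> {0..1}" "x \<in> X" for t x
    using that q_eq_z0_iff[of x] q_eq_z0_iff[OF GX[OF that]] GC[of t x] q_inv_q[of x]
    by (cases "x \<in> C") (auto simp: G'_def)
  have G'Z: "G' (t, z) \<in> Z" if "t \<in> {0..1}" "z \<in> Z" for t z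
    using that z0_in q_in GX q_inv_in[of z] by (auto simp: G'_def)
  have cont_G': "continuous_on ({0..1} \<times> Z) G'"
  proof (rule continuous_on_collapse)
    have "continuous_on ({0..1} \<times> X) (\<lambda>y. q (G y))"
      using G(2) by (intro continuous_on_compose2[OF cont_q G(1)]) auto
    then show "continuous_on ({0..1} \<times> X) (\<lambda>(t, x). G' (t, q x))"
      by (rule continuous_on_eq) (auto simp: G'q)
  qed (auto simp: G'_def)
  have cont_slice: "continuous_on S (\<lambda>x. F (1, x))"
    if "continuous_on ({0..1} \<times> S) F" for F :: "real \<times> 's::topological_space \<Rightarrow> 't::topological_space" and S
    by (intro continuous_on_compose2[OF that] continuous_intros) auto
  have c\<phi>: "continuous_map (top_of_set X) (top_of_set X) ?\<phi>"
    using cont_slice[OF G(1)] GX by auto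
  have c\<phi>': "continuous_map (top_of_set Z) (top_of_set Z) ?\<phi>'"
    using cont_slice[OF cont_G'] G'Z by auto
  have cq: "continuous_map (top_of_set X) (top_of_set Z) q"
    using cont_q q_in by auto
  let ?HX = "\<lambda>S. relative_homology_group p (top_of_set X) S"
  let ?HZ = "\<lambda>S. relative_homology_group p (top_of_set Z) S"
  have id_X: "hom_induced p (top_of_set X) C (top_of_set X) C ?\<phi> a = a"
    if a: "a \<in> carrier (?HX C)" for a
  proof -
    have "homotopic_with (\<lambda>h. h \<in> C \<rightarrow> C) (top_of_set X) (top_of_set X) (\<lambda>x. G (0, x)) ?\<phi>"
      unfolding homotopic_with_def using G GC
      by (intro exI[of _ G]) (auto simp: simp flip: subtopology_Times)
    note * = homology_homotopy_axiom[OF this] homotopic_with_imp_continuous_maps[OF this]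
    \<comment> \<open>The start of the homotopy is known to be the identity on \<open>X\<close>
      only, not as a function on the whole type.\<close>
    have "hom_induced p (top_of_set X) C (top_of_set X) C (\<lambda>x. G (0, x)) a = a"
      by (rule hom_induced_id_gen[OF _ _ a]) (use * G0 in auto)
    then show ?thesis
      by (simp only: *)
  qed
  have id_Z: "hom_induced p (top_of_set Z) {z0} (top_of_set Z) {z0} ?\<phi>' a = a"
    if a: "a \<in> carrier (?HZ {z0})" for a
  proof -
    have G'0: "G' (0, z) = z" if "z \<in> Z" for z
      using that q_inv_in[of z] q_q_inv[of z] G0 by (auto simp: G'_def)
    have "homotopic_with (\<lambda>h. h \<in> {z0} \<rightarrow> {z0}) (top_of_set Z) (top_of_set Z) (\<lambda>x. G' (0, x)) ?\<phi>'"
      unfolding homotopic_with_def using cont_G' G'Z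
      by (intro exI[of _ G']) (auto simp: G'_def simp flip: subtopology_Times)
    note * = homology_homotopy_axiom[OF this] homotopic_with_imp_continuous_maps[OF this]
    have "hom_induced p (top_of_set Z) {z0} (top_of_set Z) {z0} (\<lambda>x. G' (0, x)) a = a"
      by (rule hom_induced_id_gen[OF _ _ a]) (use * G'0 in auto)
    then show ?thesis
      by (simp only: *)
  qed
  let ?exX = "hom_induced p (top_of_set (X - C)) (U - C) (top_of_set X) U id"
  let ?exZ = "hom_induced p (top_of_set (Z - {z0})) (W - {z0}) (top_of_set Z) W id"
  let ?qD = "hom_induced p (top_of_set (X - C)) (U - C) (top_of_set (Z - {z0})) (W - {z0}) q"
  let ?qU = "hom_induced p (top_of_set X) U (top_of_set Z) W q"
  let ?qC = "hom_induced p (top_of_set X) C (top_of_set Z) {z0} q"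
  have bij_exX: "bij_betw ?exX
      (carrier (relative_homology_group p (top_of_set (X - C)) (U - C))) (carrier (?HX U))"
  proof -
    have "closedin (top_of_set X) C"
      using compact_C C_subset by (simp add: closed_subset compact_imp_closed)
    then have "top_of_set X closure_of C \<subseteq> top_of_set X interior_of U"
      using U by (simp add: closure_of_closedin interior_of_openin)
    from homology_excision_axiom[OF this UX, of p] show ?thesis
      by (simp add: subtopology_subtopology iso_def Int_absorb1 Diff_subset Int_commute)
  qed
  have bij_exZ: "bij_betw ?exZ
      (carrier (relative_homology_group p (top_of_set (Z - {z0})) (W - {z0}))) (carrier (?HZ W))"
  proof -
    have "closedin (top_of_set Z) {z0}"
      using z0_in by (simp add: closed_subset)
    then have *: "top_of_set Z closure_of {z0} \<subseteq> top_of_set Z interior_of W"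
      using opW z0W by (simp add: closure_of_closedin interior_of_openin)
    have "W \<subseteq> Z"
      by (auto simp: W_def)
    from homology_excision_axiom[OF * this, of p] show ?thesis
      by (simp add: subtopology_subtopology iso_def Int_absorb1 Diff_subset Int_commute)
  qed
  have q_UC: "q \<in> (U - C) \<rightarrow> W - {z0}"
    using q_in_W_iff q_eq_z0_iff UX by auto
  have bij_q0: "bij_betw ?qD
      (carrier (relative_homology_group p (top_of_set (X - C)) (U - C)))
      (carrier (relative_homology_group p (top_of_set (Z - {z0})) (W - {z0})))"
  proof -
    have hom: "homeomorphic_maps (top_of_set (X - C)) (top_of_set (Z - {z0})) q q_inv"
      using homeomorphism_complement by simp
    have q_inv: "q_inv \<in> W - {z0} \<rightarrow> U - C"
    proof
      fix z assume z: "z \<in> W - {z0}"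
      then have "z \<in> Z"
        by (simp add: W_def)
      then show "q_inv z \<in> U - C"
        using z q_inv_in[of z] q_q_inv[of z] q_in_W_iff[of "q_inv z"] by auto
    qed
    from group_isomorphisms_imp_iso[OF
        homeomorphic_maps_relative_homology_group_isomorphisms[OF hom q_UC q_inv, of p]]
    show ?thesis
      by (simp add: iso_def)
  qed
  have q_U: "q \<in> U \<rightarrow> W"
    using q_in_W_iff UX by auto
  \<comment> \<open>In the square of \<open>?exX\<close>, \<open>?qD\<close>, \<open>?exZ\<close>
    and \<open>?qU\<close>, three sides are bijective by excision and by the homeomorphism of
    complements, hence so is the fourth.\<close>
  have bij_qU: "bij_betw ?qU (carrier (?HX U)) (carrier (?HZ W))"
  proof -
    have cqC: "continuous_map (top_of_set (X - C)) (top_of_set (Z - {z0})) q"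
      using homeomorphism_complement by (auto simp: homeomorphism_def)
    have "?qU \<circ> ?exX = hom_induced p (top_of_set (X - C)) (U - C) (top_of_set Z) W q"
      by (subst hom_induced_compose[symmetric]) (use cq q_U in auto)
    also have "\<dots> = ?exZ \<circ> ?qD"
      by (subst hom_induced_compose[symmetric]) (use cqC q_UC in auto)
    finally show ?thesis
      using bij_betw_comp_iff[OF bij_exX] bij_betw_trans[OF bij_q0 bij_exZ] by metis
  qed
  have qC: "q \<in> C \<rightarrow> {z0}"
    using q_C by auto
  have inj: "inj_on ?qC (carrier (?HX C))"
  proof (rule inj_onI)
    fix a b assume ab: "a \<in> carrier (?HX C)" "b \<in> carrier (?HX C)" "?qC a = ?qC b"
    let ?i = "hom_induced p (top_of_set X) C (top_of_set X) U id"
    have "?qU (?i x) = hom_induced p (top_of_set Z) {z0} (top_of_set Z) W id (?qC x)" for x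
      using cq q_U qC U(2) z0W by (subst (1 2) hom_induced_compose') auto
    then have "?qU (?i a) = ?qU (?i b)"
      using ab by simp
    moreover have "?i a \<in> carrier (?HX U)" "?i b \<in> carrier (?HX U)"
      by (rule hom_induced_carrier)+
    ultimately have "?i a = ?i b"
      using bij_qU by (auto simp: bij_betw_def dest: inj_onD)
    \<comment> \<open>Applying the end map of \<open>G\<close> after the inclusion into
      \<open>(X, U)\<close> recovers the class, so the inclusion is injective on homology.\<close>
    moreover have "hom_induced p (top_of_set X) U (top_of_set X) C ?\<phi> (?i x) =
        hom_induced p (top_of_set X) C (top_of_set X) C ?\<phi> x" for x
      using c\<phi> U(2) G1 by (subst hom_induced_compose') auto
    ultimately show "a = b"
      using id_X ab by metis
  qed
  have surj: "b \<in> ?qC ` carrier (?HX C)" if b: "b \<in> carrier (?HZ {z0})" for b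
  proof -
    let ?j = "hom_induced p (top_of_set Z) {z0} (top_of_set Z) W id"
    let ?r = "hom_induced p (top_of_set X) U (top_of_set X) C ?\<phi>"
    let ?r' = "hom_induced p (top_of_set Z) W (top_of_set Z) {z0} ?\<phi>'"
    have "?j b \<in> carrier (?HZ W)"
      by (rule hom_induced_carrier)
    \<comment> \<open>The class of \<open>b\<close> is lifted through the bijection for
      \<open>U\<close> and \<open>W\<close>, then pushed into \<open>(X, C)\<close> by the end map
      of \<open>G\<close>.\<close>
    then obtain a where a: "?qU a = ?j b"
      using bij_qU unfolding bij_betw_def by (metis imageE)
    have \<phi>'W: "?\<phi>' \<in> W \<rightarrow> {z0}"
    proof
      fix z assume z: "z \<in> W"
      show "?\<phi>' z \<in> {z0}"
      proof (cases "z = z0")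
        case False
        moreover have "z \<in> Z"
          using z by (simp add: W_def)
        ultimately have "q_inv z \<in> X" "q (q_inv z) = z"
          using q_inv_in[of z] q_q_inv[of z] by auto
        then have "G (1, q_inv z) \<in> C"
          using z q_in_W_iff[of "q_inv z"] G1 by simp
        then show ?thesis
          using q_C by (auto simp: G'_def)
      qed (simp add: G'_def)
    qed
    have "?qC (?r a) = hom_induced p (top_of_set X) U (top_of_set Z) {z0} (q \<circ> ?\<phi>) a"
      using c\<phi> G1 cq qC by (intro hom_induced_compose') auto
    also have "\<dots> = hom_induced p (top_of_set X) U (top_of_set Z) {z0} (?\<phi>' \<circ> q) a"
      by (subst hom_induced_eq[of _ _ "?\<phi>' \<circ> q"]) (simp_all add: G'q)
    also have "\<dots> = ?r' (?qU a)"
      using c\<phi>' cq q_U \<phi>'W by (intro hom_induced_compose'[symmetric]) auto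
    also have "\<dots> = ?r' (?j b)"
      by (simp add: a)
    also have "\<dots> = hom_induced p (top_of_set Z) {z0} (top_of_set Z) {z0} ?\<phi>' b"
      using c\<phi>' \<phi>'W z0W by (subst hom_induced_compose') auto
    also have "\<dots> = b"
      using b by (rule id_Z)
    finally have "b = ?qC (?r a)" ..
    then show ?thesis
      using hom_induced_carrier by (rule image_eqI)
  qed
  have "bij_betw ?qC (carrier (?HX C)) (carrier (?HZ {z0}))"
    using inj surj by (intro bij_betw_imageI equalityI image_subsetI subsetI hom_induced_carrier)
  then show ?thesis
    by (simp add: iso_def hom_induced_hom)
qed

end

text \<open>The one-point compactification depends only on the complement, so \<open>Z\<close> is a
  collapse of \<open>(Y, D)\<close> as well. Continuity at \<open>D\<close> holds since closed sets
  missing \<open>z0\<close> have compact preimages.\<close>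

lemma (in collapse) collapse_transfer:
  assumes Y: "compact Y" and D: "compact D" "D \<subseteq> Y" and h: "homeomorphism (X - C) (Y - D) h h'"
  shows "collapse Y D Z z0 (\<lambda>y. if y \<in> D then z0 else q (h' y))"
proof -
  define k where "k y = (if y \<in> D then z0 else q (h' y))" for y
  have h'h: "h' (h x) = x" "h x \<in> Y" "h x \<notin> D" if "x \<in> X" "x \<notin> C" for x
    using h that by (auto simp: homeomorphism_def)
  have hh': "h (h' y) = y" "h' y \<in> X" "h' y \<notin> C" if "y \<in> Y" "y \<notin> D" for y
    using h that by (auto simp: homeomorphism_def)
  have vimage: "k -` B \<inter> Y = h ` (q -` B \<inter> X)" if B: "z0 \<notin> B" for B
  proof (intro equalityI subsetI)
    fix y assume y: "y \<in> k -` B \<inter> Y"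
    then have "y \<notin> D"
      using B by (auto simp: k_def)
    then have "y = h (h' y)" "h' y \<in> q -` B \<inter> X"
      using y hh'[of y] by (auto simp: k_def)
    then show "y \<in> h ` (q -` B \<inter> X)"
      by (rule image_eqI)
  next
    fix y assume "y \<in> h ` (q -` B \<inter> X)"
    then obtain x where x: "y = h x" "x \<in> X" "q x \<in> B"
      by blast
    then have "x \<notin> C"
      using B q_eq_z0_iff[of x] by auto
    then show "y \<in> k -` B \<inter> Y"
      using x h'h[of x] by (auto simp: k_def)
  qed
  have sub: "q -` B \<inter> X \<subseteq> X - C" if "z0 \<notin> B" for B
    using that q_eq_z0_iff by auto
  have "closed (k -` B \<inter> Y)" if B: "closed B" for B
  proof (cases "z0 \<in> B")
    case False
    \<comment> \<open>This preimage is compact and avoids \<open>C\<close>, so \<open>h\<close> maps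
      it to a compact set.\<close>
    have "closed (q -` B \<inter> X)"
      using cont_q B compact_X by (simp add: continuous_on_closed_vimage compact_imp_closed)
    then have "compact (q -` B \<inter> X)"
      using compact_X compact_Int_closed[of X "q -` B \<inter> X"] by (simp add: Int_ac)
    moreover have "continuous_on (q -` B \<inter> X) h"
      using h sub[OF False] continuous_on_subset unfolding homeomorphism_def by metis
    ultimately show ?thesis
      by (simp add: vimage False compact_imp_closed compact_continuous_image)
  next
    case True
    \<comment> \<open>Here the complement of \<open>B\<close> misses \<open>z0\<close>; its preimage
      is open in \<open>X - C\<close>, is carried by \<open>h\<close> to an open subset of
      \<open>Y - D\<close>, and stays open in \<open>Y\<close>.\<close>
    have "openin (top_of_set X) (X \<inter> q -` (- B))"
      using B by (intro continuous_openin_preimage_gen cont_q open_Compl)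
    then have "openin (top_of_set X) (q -` (- B) \<inter> X)"
      by (simp only: Int_commute)
    then have "openin (top_of_set (X - C)) (q -` (- B) \<inter> X)"
      by (rule openin_subset_trans) (use True sub in auto)
    then have "openin (top_of_set (Y - D)) (k -` (- B) \<inter> Y)"
      using True homeomorphism_imp_open_map[OF h] by (simp only: vimage Compl_iff not_not simp_thms)
    moreover have "openin (top_of_set Y) (Y - D)"
      using D by (simp add: Diff_eq openin_open_Int compact_imp_closed open_Compl)
    ultimately have "openin (top_of_set Y) (k -` (- B) \<inter> Y)"
      by (rule openin_trans)
    then have "closedin (top_of_set Y) (Y - k -` (- B) \<inter> Y)"
      using closedin_diff[OF closedin_topspace] by fastforce
    moreover have "Y - k -` (- B) \<inter> Y = k -` B \<inter> Y"
      by auto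
    ultimately show ?thesis
      using Y by (metis closedin_closed_eq compact_imp_closed)
  qed
  then have "continuous_on Y k"
    using Y by (simp add: continuous_on_closed_vimage compact_imp_closed)
  moreover have "bij_betw k (Y - D) (Z - {z0})"
  proof -
    have "bij_betw h' (Y - D) (X - C)"
      using h unfolding homeomorphism_def
      by (intro bij_betw_imageI inj_on_inverseI[of _ h]) blast+
    from bij_betw_trans[OF this bij_q] show ?thesis
      by (rule bij_betw_cong[THEN iffD1, rotated]) (simp add: k_def)
  qed
  ultimately have "collapse Y D Z z0 k"
    using Y D z0_in by unfold_locales (auto simp: k_def)
  then show ?thesis
    unfolding k_def .
qed

text \<open>
  Scaling by the distance from \<open>C\<close> realises the quotient \<open>X / C\<close> inside a Euclidean space; for
  \<open>C = {}\<close> the base point is added to a copy of \<open>X\<close> at height \<open>1\<close>.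
\<close>

lemma collapse_exists:
  fixes X C :: "'a::real_normed_vector set"
  assumes "compact X" "compact C" "C \<subseteq> X"
  obtains Z and q :: "'a \<Rightarrow> real \<times> 'a" where "collapse X C Z 0 q"
proof -
  \<comment> \<open>The distance to the empty set is 0 by convention, so empty \<open>C\<close> gets
    height 1. In either case \<open>d\<close> vanishes exactly on \<open>C\<close>.\<close>
  define d where "d x = (if C = {} then 1 else infdist x C)" for x
  \<comment> \<open>Off \<open>C\<close> the nonzero first coordinate can be divided out, so the
    point is recovered; all of \<open>C\<close> goes to 0.\<close>
  define q where "q x = (d x, d x *\<^sub>R x)" for x
  have d: "d x = 0 \<longleftrightarrow> x \<in> C" for x
    using assms(2) by (simp add: d_def in_closed_iff_infdist_zero compact_imp_closed)
  have "continuous_on X d"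
    unfolding d_def by (cases "C = {}") (auto intro!: continuous_on_infdist continuous_on_id)
  then have cont: "continuous_on X q"
    unfolding q_def by (intro continuous_intros)
  have "inj_on q (X - C)"
  proof (rule inj_onI)
    fix x y assume x: "x \<in> X - C" and q: "q x = q y"
    then have "d x *\<^sub>R x = d x *\<^sub>R y"
      unfolding q_def by (metis Pair_inject)
    with x show "x = y"
      using d[of x] by simp
  qed
  moreover have "q ` (X - C) = insert 0 (q ` X) - {0}"
    using d assms(3) by (auto simp: q_def zero_prod_def)
  ultimately have "collapse X C (insert 0 (q ` X)) 0 q"
    using assms cont d by unfold_locales (auto simp: bij_betw_def q_def zero_prod_def)
  then show ?thesis
    by (rule that)
qed

lemma homology_trace_collapse:
  fixes X C :: "'a::euclidean_space set"
  assumes col: "collapse X C Z z0 q" and "ANR X" "ANR C"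
    and f: "continuous_on X f" "f \<in> X \<rightarrow> X" "f \<in> C \<rightarrow> C"
    and f': "continuous_on Z f'" "f' \<in> Z \<rightarrow> Z" "f' z0 = z0"
    and comm: "\<And>x. x \<in> X \<Longrightarrow> q (f x) = f' (q x)"
  shows "homology_trace p (top_of_set X) C f = homology_trace p (top_of_set Z) {z0} f'"
proof -
  interpret collapse X C Z z0 q by (fact col)
  have "closedin (top_of_set X) C"
    using compact_C C_subset by (simp add: closed_subset compact_imp_closed)
  then obtain U and G :: "real \<times> 'a \<Rightarrow> 'a" where
    "openin (top_of_set X) U" "C \<subseteq> U"
    "continuous_on ({0..1} \<times> X) G" "G \<in> {0..1} \<times> X \<rightarrow> X"
    "\<And>x. x \<in> X \<Longrightarrow> G (0, x) = x" "\<And>t c. t \<in> {0..1} \<Longrightarrow> c \<in> C \<Longrightarrow> G (t, c) = c"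
    "\<And>x. x \<in> U \<Longrightarrow> G (1, x) \<in> C"
    using ANR_pair_deformation[OF \<open>ANR X\<close> \<open>ANR C\<close>] by metis
  then have "hom_induced p (top_of_set X) C (top_of_set Z) {z0} q
    \<in> iso (relative_homology_group p (top_of_set X) C)
          (relative_homology_group p (top_of_set Z) {z0})" for p
    by (intro iso_relative_homology[of U G]) simp_all
  then show ?thesis
    using f f' comm cont_q q_in q_C by (intro homology_trace_eqI[where q = q]) auto
qed

text \<open>As \<open>f\<close> keeps \<open>C\<close> inside \<open>C\<close>, the composite of
  \<open>q\<close> and \<open>f\<close> is constant on the fibres of \<open>q\<close>.\<close>

lemma (in collapse) induced_map:
  assumes f: "continuous_on X f" "f \<in> X \<rightarrow> X" "f \<in> C \<rightarrow> C"
  obtains f' where "continuous_on Z f'" "f' \<in> Z \<rightarrow> Z" "f' z0 = z0"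
    "\<And>x. x \<in> X \<Longrightarrow> q (f x) = f' (q x)"
proof -
  define f' where "f' z = (if z = z0 then z0 else q (f (q_inv z)))" for z
  have f'q: "f' (q x) = q (f x)" if "x \<in> X" for x
  proof (cases "x \<in> C")
    case True
    then have "q x = z0" "q (f x) = z0"
      using that f q_C by auto
    then show ?thesis
      by (simp add: f'_def)
  qed (use that q_eq_z0_iff[of x] q_inv_q[of x] in \<open>simp add: f'_def\<close>)
  \<comment> \<open>\<open>continuous_on_collapse\<close> speaks of maps with a real parameter, so a
    one-point parameter space is supplied.\<close>
  have "continuous_on ({0::real} \<times> Z) (\<lambda>y. f' (snd y))"
  proof (rule continuous_on_collapse)
    have "continuous_on ({0::real} \<times> X) (\<lambda>y. q (f (snd y)))"
      using f(2) by (intro continuous_on_compose2[OF cont_q] continuous_on_compose2[OF f(1)]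
          continuous_intros) auto
    then show "continuous_on ({0::real} \<times> X) (\<lambda>(t, x). f' (snd (t, q x)))"
      by (rule continuous_on_eq) (auto simp: f'q)
  qed (auto simp: f'_def)
  then have "continuous_on Z (\<lambda>z. f' (snd (0::real, z)))"
    by (rule continuous_on_compose2) (auto intro!: continuous_intros)
  moreover have "f' \<in> Z \<rightarrow> Z"
    using z0_in q_inv_in f(2) q_in by (auto simp: f'_def Pi_iff)
  ultimately show ?thesis
    using f'q that[of f'] by (simp add: f'_def)
qed

section \<open>Polyhedral pairs with conjugate complements\<close>

text \<open>Simplices are compact and convex, and a finite union of closed convex sets is an
  ANR.\<close>

lemma simplicial_complex_polyhedron:
  fixes K :: "'a::euclidean_space set set"
  assumes "simplicial_complex K"
  shows "compact (\<Union>K)" "ANR (\<Union>K)"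
proof -
  have fin: "finite K" and simplex: "\<And>S. S \<in> K \<Longrightarrow> \<exists>n. n simplex S"
    using assms unfolding simplicial_complex_def by blast+
  then have "compact S" "convex S" if "S \<in> K" for S
    using that compact_simplex convex_simplex by blast+
  with fin show "compact (\<Union>K)" "ANR (\<Union>K)"
    by (auto intro!: compact_Union ANR_finite_Union_convex_closed compact_imp_closed)
qed

text \<open>Both sides are computed from one self-map \<open>f'\<close> of \<open>(Z, 0)\<close>, so
  the homology traces agree in every degree.\<close>

lemma lefschetz_number_complement:
  fixes X C :: "'a::euclidean_space set" and Y D :: "'b::euclidean_space set"
  assumes X: "compact X" "ANR X" and C: "compact C" "ANR C" "C \<subseteq> X"
    and Y: "compact Y" "ANR Y" and D: "compact D" "ANR D" "D \<subseteq> Y"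
    and h: "homeomorphism (X - C) (Y - D) h h'"
    and conj: "\<And>x. x \<in> X - C \<Longrightarrow> g (h x) = h (f x)"
    and f: "continuous_on X f" "f ` C \<subseteq> C" "f ` (X - C) \<subseteq> X - C"
    and g: "continuous_on Y g" "g ` D \<subseteq> D" "g ` (Y - D) \<subseteq> Y - D"
  shows "lefschetz_number f (top_of_set X) C = lefschetz_number g (top_of_set Y) D"
proof -
  obtain Z and q :: "'a \<Rightarrow> real \<times> 'a" where col: "collapse X C Z 0 q"
    using collapse_exists[OF X(1) C(1,3)] .
  define k where "k y = (if y \<in> D then 0 else q (h' y))" for y
  have colY: "collapse Y D Z 0 k"
    unfolding k_def using collapse.collapse_transfer[OF col Y(1) D(1,3) h] .
  have fX: "f \<in> X \<rightarrow> X" "f \<in> C \<rightarrow> C" and gY: "g \<in> Y \<rightarrow> Y" "g \<in> D \<rightarrow> D"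
    using f g C(3) D(3) by blast+
  obtain f' where f': "continuous_on Z f'" "f' \<in> Z \<rightarrow> Z" "f' 0 = 0"
    and qf: "\<And>x. x \<in> X \<Longrightarrow> q (f x) = f' (q x)"
    using collapse.induced_map[OF col f(1) fX] by blast
  \<comment> \<open>On \<open>D\<close> both sides are the base point. Elsewhere
    \<open>y = h x\<close>, and \<open>f x\<close> stays outside \<open>C\<close>, so the conjugacy
    turns \<open>g\<close> into \<open>f\<close>.\<close>
  have "k (g y) = f' (k y)" if y: "y \<in> Y" for y
  proof (cases "y \<in> D")
    case True
    then show ?thesis
      using gY f' by (auto simp: k_def)
  next
    case False
    define x where "x = h' y"
    have x: "x \<in> X - C" "y = h x"
      using h y False by (auto simp: x_def homeomorphism_def)
    then have fx: "f x \<in> X - C" "g y = h (f x)"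
      using f(3) conj by auto
    then have "h' (g y) = f x" "g y \<notin> D"
      using h by (auto simp: homeomorphism_def)
    then have "k (g y) = q (f x)"
      by (simp add: k_def)
    moreover have "k y = q x"
      using False by (simp add: k_def x_def)
    ultimately show ?thesis
      using qf x(1) by simp
  qed
  then have "homology_trace p (top_of_set X) C f = homology_trace p (top_of_set Y) D g" for p
    using homology_trace_collapse[OF col X(2) C(2) f(1) fX f' qf]
      homology_trace_collapse[OF colY Y(2) D(2) g(1) gY f'] by metis
  then show ?thesis
    by (simp add: lefschetz_number_def)
qed

theorem corollary3p4:
  fixes K L :: "'a::euclidean_space set set" and M N :: "'b::euclidean_space set set"
    and X C :: "'a set" and Y D :: "'b set"
    and f :: "'a \<Rightarrow> 'a" and g :: "'b \<Rightarrow> 'b" and h :: "'a \<Rightarrow> 'b"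
  assumes "simplicial_complex K" and "simplicial_complex L" and "L \<subseteq> K"
    and "simplicial_complex M" and "simplicial_complex N" and "N \<subseteq> M"
    and "X = \<Union>K" and "C = \<Union>L" and "Y = \<Union>M" and "D = \<Union>N"
    and "\<exists>h'. homeomorphism (X - C) (Y - D) h h'"
    and "\<forall>x \<in> X - C. g (h x) = h (f x)"
  shows "((\<exists>f'. homeomorphism X X f f') \<and> f ` C = C \<and>
          (\<exists>g'. homeomorphism Y Y g g') \<and> g ` D = D \<longrightarrow>
            lefschetz_number f (top_of_set X) C = lefschetz_number g (top_of_set Y) D) \<and>
         (continuous_on X f \<and> open_map (top_of_set X) (top_of_set X) f \<and>
          f ` C \<subseteq> C \<and> f ` (X - C) \<subseteq> X - C \<and>
          continuous_on Y g \<and> open_map (top_of_set Y) (top_of_set Y) g \<and>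
          g ` D \<subseteq> D \<and> g ` (Y - D) \<subseteq> Y - D \<longrightarrow>
            lefschetz_number f (top_of_set X) C = lefschetz_number g (top_of_set Y) D)"
proof -
  have compact: "compact X" "compact C" "compact Y" "compact D"
    and ANR: "ANR X" "ANR C" "ANR Y" "ANR D"
    by (simp_all add: assms simplicial_complex_polyhedron)
  have sub: "C \<subseteq> X" "D \<subseteq> Y"
    using assms(3,6-10) by auto
  obtain h' where h: "homeomorphism (X - C) (Y - D) h h'"
    using assms(11) ..
  have main: "lefschetz_number f (top_of_set X) C = lefschetz_number g (top_of_set Y) D"
    if "continuous_on X f" "f ` C \<subseteq> C" "f ` (X - C) \<subseteq> X - C"
      "continuous_on Y g" "g ` D \<subseteq> D" "g ` (Y - D) \<subseteq> Y - D"
    using compact ANR sub h that assms(12) by (intro lefschetz_number_complement) auto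
  \<comment> \<open>An injective map of \<open>S\<close> onto itself with \<open>T\<close> mapped
    onto \<open>T\<close> preserves the complement; this brings the homeomorphism case under
    \<open>main\<close>.\<close>
  have complement: "e ` (S - T) \<subseteq> S - T"
    if e: "homeomorphism S S e e'" "e ` T = T" and "T \<subseteq> S"
    for S T :: "'c::euclidean_space set" and e e'
  proof -
    have "inj_on e S"
      by (rule inj_on_inverseI[of _ e']) (use e(1) in \<open>simp add: homeomorphism_def\<close>)
    moreover have "e ` S = S"
      using e(1) by (rule homeomorphism_image1)
    ultimately show ?thesis
      using e(2) \<open>T \<subseteq> S\<close> by (simp add: inj_on_image_set_diff[of e S])
  qed
  show ?thesis
  proof (intro conjI impI; elim conjE exE)
    fix f' g' assume "homeomorphism X X f f'" "f ` C = C" "homeomorphism Y Y g g'" "g ` D = D"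
    then show "lefschetz_number f (top_of_set X) C = lefschetz_number g (top_of_set Y) D"
      by (intro main complement[OF _ _ sub(1)] complement[OF _ _ sub(2)])
        (simp_all add: homeomorphism_cont1)
  qed (rule main)
qed

end
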